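(* Let $Q$ be a smooth $n$-dimensional manifold, let $H\in C^\infty(T^*Q)$ with Hamiltonian vector field $Z_H$, let $\alpha\in\Omega^1(Q)$ be a 1-form, regarded as a section $\alpha\colon Q\to T^*Q$, and let $X=T\pi_Q\circ Z_H\circ\alpha$ be the vector field on $Q$ associated with $\alpha$. Then $\alpha$ is a solution of the generalized Hamiltonian Hamilton--Jacobi problem for $Z_H$ if, and only if, $$i(X)\,d\alpha=-d(\alpha^*H).$$
   Context: Let $\pi_Q\colon T^*Q\to Q$ be the cotangent bundle with canonical 1-form $\theta=p_i\,dq^i$ and canonical symplectic form $\omega=-d\theta$. The Hamiltonian vector field $Z_H$ of $H\in C^\infty(T^*Q)$ is the unique vector field on $T^*Q$ with $i(Z_H)\omega=dH$. A 1-form $\alpha\in\Omega^1(Q)$ is a solution of the generalized Hamiltonian Hamilton--Jacobi problem for $Z_H$ if, for every integral curve $\gamma$ (defined on an open interval) of the vector field $X=T\pi_Q\circ Z_H\circ\alpha$ on $Q$, the curve $\alpha\circ\gamma$ in $T^*Q$ is an integral curve of $Z_H$. *)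

theory Defs
  imports "HOL-Analysis.Analysis"
begin

section \<open>Smooth maps between open subsets of Euclidean spaces\<close>

text \<open>
  For an open set \<open>S\<close> in a Euclidean space, \<open>Ck_on k S f\<close> says that \<open>f\<close> is of class \<open>C\<^sup>k\<close>
  on \<open>S\<close>: derivatives are taken direction by direction, so that the target type does not
  change with the order of differentiation.
\<close>

primrec Ck_on ::
  "nat \<Rightarrow> 'e::real_normed_vector set \<Rightarrow> ('e \<Rightarrow> 'f::real_normed_vector) \<Rightarrow> bool" where
  "Ck_on 0 S f \<longleftrightarrow> continuous_on S f"
| "Ck_on (Suc k) S f \<longleftrightarrow>
     (\<forall>x\<in>S. f differentiable (at x)) \<and> (\<forall>v. Ck_on k S (\<lambda>x. frechet_derivative f (at x) v))"

definition smooth_on ::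
  "'e::real_normed_vector set \<Rightarrow> ('e \<Rightarrow> 'f::real_normed_vector) \<Rightarrow> bool" where
  "smooth_on S f \<longleftrightarrow> (\<forall>k. Ck_on k S f)"


section \<open>Charts, atlases and smooth manifolds\<close>

text \<open>
  A chart is a domain together with a coordinate map; the values of the map outside the
  domain play no role. The model space is a Euclidean space \<open>'e\<close>, so a manifold with charts
  in \<open>'e\<close> has dimension \<open>DIM('e)\<close>.
\<close>

type_synonym ('a, 'e) chart = "'a set \<times> ('a \<Rightarrow> 'e)"

abbreviation chart_dom :: "('a, 'e) chart \<Rightarrow> 'a set" where
  "chart_dom c \<equiv> fst c"

abbreviation chart_map :: "('a, 'e) chart \<Rightarrow> 'a \<Rightarrow> 'e" where
  "chart_map c \<equiv> snd c"

definition chart_img :: "('a, 'e) chart \<Rightarrow> 'e set" where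
  "chart_img c = chart_map c ` chart_dom c"

definition chart_inv :: "('a, 'e) chart \<Rightarrow> 'e \<Rightarrow> 'a" where
  "chart_inv c = inv_into (chart_dom c) (chart_map c)"

definition transition :: "('a, 'e) chart \<Rightarrow> ('a, 'e) chart \<Rightarrow> 'e \<Rightarrow> 'e" where
  "transition c d = chart_map d \<circ> chart_inv c"

definition smooth_atlas :: "('a, 'e::euclidean_space) chart set \<Rightarrow> bool" where
  "smooth_atlas A \<longleftrightarrow>
     (\<forall>c\<in>A. inj_on (chart_map c) (chart_dom c) \<and> open (chart_img c)) \<and>
     (\<forall>c\<in>A. \<forall>d\<in>A. open (chart_map c ` (chart_dom c \<inter> chart_dom d)) \<and>
        smooth_on (chart_map c ` (chart_dom c \<inter> chart_dom d)) (transition c d))"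

definition carrier :: "('a, 'e) chart set \<Rightarrow> 'a set" where
  "carrier A = (\<Union>c\<in>A. chart_dom c)"

text \<open>
  The manifold topology is the one generated by the atlas; for a smooth atlas it is the unique
  topology on the carrier in which chart domains are open and charts are homeomorphisms onto
  their images.
\<close>

definition manifold_open :: "('a, 'e::euclidean_space) chart set \<Rightarrow> 'a set \<Rightarrow> bool" where
  "manifold_open A W \<longleftrightarrow>
     W \<subseteq> carrier A \<and> (\<forall>c\<in>A. open (chart_map c ` (W \<inter> chart_dom c)))"

definition manifold_topology :: "('a, 'e::euclidean_space) chart set \<Rightarrow> 'a topology" where
  "manifold_topology A = topology (manifold_open A)"

lemma istopology_manifold_open:
  assumes "smooth_atlas A"
  shows "istopology (manifold_open A)"
proof -
  have inj: "inj_on (chart_map c) (chart_dom c)" if "c \<in> A" for c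
    using assms that by (auto simp: smooth_atlas_def)
  have "manifold_open A (S \<inter> T)" if S: "manifold_open A S" and T: "manifold_open A T" for S T
  proof -
    have "chart_map c ` (S \<inter> T \<inter> chart_dom c) =
        chart_map c ` (S \<inter> chart_dom c) \<inter> chart_map c ` (T \<inter> chart_dom c)" if "c \<in> A" for c
      using inj[OF that] by (auto simp: inj_on_def)
    then show ?thesis using S T by (auto simp: manifold_open_def intro!: open_Int)
  qed
  moreover have "manifold_open A (\<Union>\<K>)" if "\<forall>K\<in>\<K>. manifold_open A K" for \<K>
  proof -
    have "chart_map c ` (\<Union>\<K> \<inter> chart_dom c) = (\<Union>K\<in>\<K>. chart_map c ` (K \<inter> chart_dom c))" for c
      by auto
    then show ?thesis using that unfolding manifold_open_def by (metis (mono_tags, lifting) Sup_le_iff open_UN)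
  qed
  ultimately show ?thesis by (auto simp: istopology_def)
qed

lemma openin_manifold_topology:
  "smooth_atlas A \<Longrightarrow> openin (manifold_topology A) = manifold_open A"
  by (simp add: manifold_topology_def istopology_manifold_open topology_inverse')

definition smooth_manifold :: "('a, 'e::euclidean_space) chart set \<Rightarrow> bool" where
  "smooth_manifold A \<longleftrightarrow> smooth_atlas A \<and>
     Hausdorff_space (manifold_topology A) \<and> second_countable (manifold_topology A)"

definition charts_at :: "('a, 'e) chart set \<Rightarrow> 'a \<Rightarrow> ('a, 'e) chart set" where
  "charts_at A p = {c \<in> A. p \<in> chart_dom c}"

text \<open>
  Some chart around a point. The constructions below that use it do not depend on the choice
  when the data are smooth.
\<close>

definition chart_at :: "('a, 'e) chart set \<Rightarrow> 'a \<Rightarrow> ('a, 'e) chart" where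
  "chart_at A p = (SOME c. c \<in> charts_at A p)"

definition smooth_function :: "('a, 'e::euclidean_space) chart set \<Rightarrow> ('a \<Rightarrow> real) \<Rightarrow> bool" where
  "smooth_function A f \<longleftrightarrow> (\<forall>c\<in>A. smooth_on (chart_img c) (f \<circ> chart_inv c))"


section \<open>Tangent vectors, vector fields and integral curves\<close>

text \<open>
  A tangent vector at \<open>p\<close> assigns to each chart around \<open>p\<close> its components in that chart,
  subject to the transformation rule under change of charts. Charts of the atlas that do not
  contain \<open>p\<close>, and charts outside the atlas, get the value 0. The linear structure is pointwise.
\<close>

type_synonym ('a, 'e) tvec = "('a, 'e) chart \<Rightarrow> 'e"

definition tangent_space ::
  "('a, 'e::euclidean_space) chart set \<Rightarrow> 'a \<Rightarrow> ('a, 'e) tvec set" where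
  "tangent_space A p = {v.
     (\<forall>c. c \<notin> charts_at A p \<longrightarrow> v c = 0) \<and>
     (\<forall>c\<in>charts_at A p. \<forall>d\<in>charts_at A p.
        v d = frechet_derivative (transition c d) (at (chart_map c p)) (v c))}"

text \<open>The tangent vector at \<open>p\<close> with components \<open>u\<close> in the chart \<open>c\<close>, i.e. \<open>u\<^sup>i \<partial>/\<partial>x\<^sup>i\<close>.\<close>

definition coord_tvec ::
  "('a, 'e::euclidean_space) chart set \<Rightarrow> ('a, 'e) chart \<Rightarrow> 'a \<Rightarrow> 'e \<Rightarrow> ('a, 'e) tvec" where
  "coord_tvec A c p u = (\<lambda>d. if d \<in> charts_at A p
     then frechet_derivative (transition c d) (at (chart_map c p)) u else 0)"

text \<open>The tangent map \<open>T\<^sub>p f\<close> of \<open>f\<close>, a map from the manifold of \<open>A\<close> to that of \<open>B\<close>.\<close>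

definition tangent_map ::
  "('a, 'e::euclidean_space) chart set \<Rightarrow> ('b, 'f::euclidean_space) chart set \<Rightarrow>
   ('a \<Rightarrow> 'b) \<Rightarrow> 'a \<Rightarrow> ('a, 'e) tvec \<Rightarrow> ('b, 'f) tvec" where
  "tangent_map A B f p v = (let c = chart_at A p in
     (\<lambda>d. if d \<in> charts_at B (f p)
       then frechet_derivative (chart_map d \<circ> f \<circ> chart_inv c) (at (chart_map c p)) (v c) else 0))"

definition smooth_vector_field ::
  "('a, 'e::euclidean_space) chart set \<Rightarrow> ('a \<Rightarrow> ('a, 'e) tvec) \<Rightarrow> bool" where
  "smooth_vector_field A X \<longleftrightarrow>
     (\<forall>p\<in>carrier A. X p \<in> tangent_space A p) \<and>
     (\<forall>c\<in>A. smooth_on (chart_img c) (\<lambda>x. X (chart_inv c x) c))"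

definition has_velocity ::
  "('a, 'e::euclidean_space) chart set \<Rightarrow> (real \<Rightarrow> 'a) \<Rightarrow> ('a, 'e) tvec \<Rightarrow> real \<Rightarrow> bool" where
  "has_velocity A \<gamma> v t \<longleftrightarrow>
     \<gamma> t \<in> carrier A \<and> v \<in> tangent_space A (\<gamma> t) \<and>
     (\<forall>c\<in>charts_at A (\<gamma> t).
        (\<forall>\<^sub>F s in at t. \<gamma> s \<in> chart_dom c) \<and>
        ((chart_map c \<circ> \<gamma>) has_vector_derivative v c) (at t))"

definition integral_curve ::
  "('a, 'e::euclidean_space) chart set \<Rightarrow> ('a \<Rightarrow> ('a, 'e) tvec) \<Rightarrow> real set \<Rightarrow> (real \<Rightarrow> 'a) \<Rightarrow> bool"
  where
  "integral_curve A X I \<gamma> \<longleftrightarrow> (\<forall>t\<in>I. has_velocity A \<gamma> (X (\<gamma> t)) t)"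


section \<open>Differential forms of degree at most two\<close>

definition cotangent_space ::
  "('a, 'e::euclidean_space) chart set \<Rightarrow> 'a \<Rightarrow> (('a, 'e) tvec \<Rightarrow> real) set" where
  "cotangent_space A p = {\<xi> \<in> extensional (tangent_space A p).
     \<forall>u\<in>tangent_space A p. \<forall>v\<in>tangent_space A p. \<forall>a b.
       \<xi> (\<lambda>c. a *\<^sub>R u c + b *\<^sub>R v c) = a * \<xi> u + b * \<xi> v}"

definition smooth_one_form ::
  "('a, 'e::euclidean_space) chart set \<Rightarrow> ('a \<Rightarrow> ('a, 'e) tvec \<Rightarrow> real) \<Rightarrow> bool" where
  "smooth_one_form A \<alpha> \<longleftrightarrow>
     (\<forall>p\<in>carrier A. \<alpha> p \<in> cotangent_space A p) \<and>
     (\<forall>c\<in>A. \<forall>u. smooth_on (chart_img c)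
        (\<lambda>x. \<alpha> (chart_inv c x) (coord_tvec A c (chart_inv c x) u)))"

text \<open>The differential of a function.\<close>

definition d0 ::
  "('a, 'e::euclidean_space) chart set \<Rightarrow> ('a \<Rightarrow> real) \<Rightarrow> 'a \<Rightarrow> ('a, 'e) tvec \<Rightarrow> real" where
  "d0 A f p v = (let c = chart_at A p in
     frechet_derivative (f \<circ> chart_inv c) (at (chart_map c p)) (v c))"

text \<open>
  The exterior derivative of a 1-form; in coordinates, with \<open>\<alpha> = \<alpha>\<^sub>j dx\<^sup>j\<close>,
  this is \<open>d\<alpha>(v, w) = \<partial>\<^sub>i\<alpha>\<^sub>j (v\<^sup>i w\<^sup>j - w\<^sup>i v\<^sup>j)\<close>, i.e. \<open>d\<alpha> = d\<alpha>\<^sub>j \<and> dx\<^sup>j\<close> where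
  \<open>(\<beta> \<and> \<delta>)(v, w) = \<beta>(v) \<delta>(w) - \<beta>(w) \<delta>(v)\<close>.
\<close>

definition d1 ::
  "('a, 'e::euclidean_space) chart set \<Rightarrow> ('a \<Rightarrow> ('a, 'e) tvec \<Rightarrow> real) \<Rightarrow>
   'a \<Rightarrow> ('a, 'e) tvec \<Rightarrow> ('a, 'e) tvec \<Rightarrow> real" where
  "d1 A \<alpha> p v w = (let c = chart_at A p;
       comp = (\<lambda>u x. \<alpha> (chart_inv c x) (coord_tvec A c (chart_inv c x) u)) in
     frechet_derivative (comp (w c)) (at (chart_map c p)) (v c) -
     frechet_derivative (comp (v c)) (at (chart_map c p)) (w c))"

definition interior_product ::
  "('a \<Rightarrow> ('a, 'e) tvec) \<Rightarrow> ('a \<Rightarrow> ('a, 'e) tvec \<Rightarrow> ('a, 'e) tvec \<Rightarrow> real) \<Rightarrow>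
   'a \<Rightarrow> ('a, 'e) tvec \<Rightarrow> real" where
  "interior_product X \<omega> p v = \<omega> p (X p) v"


section \<open>The cotangent bundle\<close>

text \<open>
  Points of \<open>T\<^sup>*Q\<close> are pairs of a point \<open>q\<close> and a covector at \<open>q\<close>, with bundle projection
  \<^const>\<open>fst\<close>. The chart \<open>c\<close> of \<open>Q\<close> with coordinates \<open>q\<^sup>i\<close> induces the chart of \<open>T\<^sup>*Q\<close> with
  coordinates \<open>(q\<^sup>i, p\<^sub>i)\<close>, where \<open>p\<^sub>i\<close> is the value of the covector on \<open>\<partial>/\<partial>q\<^sup>i\<close>.
\<close>

type_synonym ('a, 'e) covec = "'a \<times> (('a, 'e) tvec \<Rightarrow> real)"

definition cotangent_chart ::
  "('a, 'e::euclidean_space) chart set \<Rightarrow> ('a, 'e) chart \<Rightarrow> (('a, 'e) covec, 'e \<times> 'e) chart" where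
  "cotangent_chart A c =
     (Sigma (chart_dom c) (cotangent_space A),
      \<lambda>(q, \<xi>). (chart_map c q, \<Sum>b\<in>Basis. \<xi> (coord_tvec A c q b) *\<^sub>R b))"

definition cotangent_atlas ::
  "('a, 'e::euclidean_space) chart set \<Rightarrow> (('a, 'e) covec, 'e \<times> 'e) chart set" where
  "cotangent_atlas A = cotangent_chart A ` A"

text \<open>The canonical 1-form \<open>\<theta>\<^sub>\<xi>(w) = \<xi>(T\<pi>(w))\<close>, i.e. \<open>\<theta> = p\<^sub>i dq\<^sup>i\<close>, and \<open>\<omega> = -d\<theta>\<close>.\<close>

definition canonical_one_form ::
  "('a, 'e::euclidean_space) chart set \<Rightarrow>
   ('a, 'e) covec \<Rightarrow> (('a, 'e) covec, 'e \<times> 'e) tvec \<Rightarrow> real" where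
  "canonical_one_form A z w = snd z (tangent_map (cotangent_atlas A) A fst z w)"

definition canonical_symplectic_form ::
  "('a, 'e::euclidean_space) chart set \<Rightarrow> ('a, 'e) covec \<Rightarrow>
   (('a, 'e) covec, 'e \<times> 'e) tvec \<Rightarrow> (('a, 'e) covec, 'e \<times> 'e) tvec \<Rightarrow> real" where
  "canonical_symplectic_form A z v w = - d1 (cotangent_atlas A) (canonical_one_form A) z v w"


section \<open>The generalized Hamiltonian Hamilton--Jacobi problem\<close>

text \<open>\<open>Z\<close> is the Hamiltonian vector field of \<open>H\<close>: the vector field with \<open>i(Z)\<omega> = dH\<close>.\<close>

definition hamiltonian_vector_field ::
  "('a, 'e::euclidean_space) chart set \<Rightarrow> (('a, 'e) covec \<Rightarrow> real) \<Rightarrow>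
   (('a, 'e) covec \<Rightarrow> (('a, 'e) covec, 'e \<times> 'e) tvec) \<Rightarrow> bool" where
  "hamiltonian_vector_field A H Z \<longleftrightarrow>
     smooth_vector_field (cotangent_atlas A) Z \<and>
     (\<forall>z\<in>carrier (cotangent_atlas A). \<forall>w\<in>tangent_space (cotangent_atlas A) z.
        interior_product Z (canonical_symplectic_form A) z w = d0 (cotangent_atlas A) H z w)"

text \<open>A 1-form \<open>\<alpha>\<close> as a section of the cotangent bundle.\<close>

definition form_section ::
  "('a \<Rightarrow> ('a, 'e) tvec \<Rightarrow> real) \<Rightarrow> 'a \<Rightarrow> ('a, 'e) covec" where
  "form_section \<alpha> q = (q, \<alpha> q)"

text \<open>The vector field \<open>X = T\<pi> \<circ> Z \<circ> \<alpha>\<close> on the base.\<close>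

definition associated_vector_field ::
  "('a, 'e::euclidean_space) chart set \<Rightarrow>
   (('a, 'e) covec \<Rightarrow> (('a, 'e) covec, 'e \<times> 'e) tvec) \<Rightarrow>
   ('a \<Rightarrow> ('a, 'e) tvec \<Rightarrow> real) \<Rightarrow> 'a \<Rightarrow> ('a, 'e) tvec" where
  "associated_vector_field A Z \<alpha> q =
     tangent_map (cotangent_atlas A) A fst (form_section \<alpha> q) (Z (form_section \<alpha> q))"

definition generalized_HJ_solution ::
  "('a, 'e::euclidean_space) chart set \<Rightarrow>
   (('a, 'e) covec \<Rightarrow> (('a, 'e) covec, 'e \<times> 'e) tvec) \<Rightarrow>
   ('a \<Rightarrow> ('a, 'e) tvec \<Rightarrow> real) \<Rightarrow> bool" where
  "generalized_HJ_solution A Z \<alpha> \<longleftrightarrow>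
     (\<forall>I \<gamma>. open I \<and> is_interval I \<and> integral_curve A (associated_vector_field A Z \<alpha>) I \<gamma> \<longrightarrow>
        integral_curve (cotangent_atlas A) Z I (form_section \<alpha> \<circ> \<gamma>))"

end

theory Submission
  imports Defs
begin

text \<open>
  In a chart \<open>(q, p)\<close> of \<open>T\<^sup>*Q\<close> write \<open>\<alpha>\<close> as the map \<open>q \<mapsto> a(q)\<close> and \<open>Z = (\<partial>H/\<partial>p, -\<partial>H/\<partial>q)\<close>. Along an
  integral curve of \<open>X = \<partial>H/\<partial>p \<circ> \<alpha>\<close> the lift \<open>(q, a(q))\<close> has velocity \<open>(X, Da(X))\<close>, so it is an
  integral curve of \<open>Z\<close> precisely when \<open>Da(X) = -\<partial>H/\<partial>q\<close> along the curve. On the other hand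
  \<open>d\<alpha>(X, v) + d(\<alpha>\<^sup>*H)(v) = (Da(X) + \<partial>H/\<partial>q) \<bullet> v\<close>, because the two terms \<open>X \<bullet> Da(v)\<close> cancel. Both
  conditions are thus the same pointwise equation; that it holds at every point when it holds along
  every integral curve uses the local existence of integral curves (Picard--Lindeloef).
\<close>

section \<open>Calculus in Euclidean spaces\<close>

text \<open>The second difference is the increment over \<open>[0, h]\<close> of \<open>f (x + s
  *\<^sub>R u + h *\<^sub>R v) - f (x + s *\<^sub>R u)\<close> as a function of \<open>s\<close>.
  The mean value theorem turns it into \<open>h\<close> times a difference of values of
  \<open>f' _ u\<close>, and the derivative \<open>A\<close> of that map at \<open>x\<close>
  evaluates this difference up to an error of order \<open>h\<close>.\<close>

lemma second_difference_estimate: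
  fixes f :: "'a::real_normed_vector \<Rightarrow> real"
  assumes "open S" "x \<in> S" and f: "\<And>y. y \<in> S \<Longrightarrow> (f has_derivative f' y) (at y)"
    and A: "((\<lambda>y. f' y u) has_derivative A) (at x)"
    and "e > 0"
  shows "\<exists>d>0. \<forall>h. 0 < h \<and> h < d \<longrightarrow>
    \<bar>f (x + h *\<^sub>R u + h *\<^sub>R v) - f (x + h *\<^sub>R u) - f (x + h *\<^sub>R v) + f x - h\<^sup>2 * A v\<bar> \<le> e * h\<^sup>2"
proof -
  \<comment> \<open>All points in play differ from \<open>x\<close> by at most \<open>h * K\<close>;
    the summand 1 keeps \<open>K\<close> positive when \<open>u\<close> and \<open>v\<close> both
    vanish.\<close>
  define K where "K = norm u + norm v + 1"
  have K: "K > 0" by (simp add: K_def add_nonneg_pos)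
  interpret A: bounded_linear A using A by (rule has_derivative_bounded_linear)
  obtain r where r: "r > 0" "ball x r \<subseteq> S" using assms(1,2) by (meson openE)
  \<comment> \<open>The linear approximation is used at two points at distance at most
    \<open>h * K\<close>, so this tolerance costs \<open>e / 2 * h\<close> each time,
    \<open>e * h\<close> together.\<close>
  obtain d where d: "d > 0" and
    est: "\<And>y. norm (y - x) < d \<Longrightarrow> \<bar>f' y u - f' x u - A (y - x)\<bar> \<le> (e / (2 * K)) * norm (y - x)"
  proof -
    have "e / (2 * K) > 0" using \<open>e > 0\<close> K by simp
    then show ?thesis using A[unfolded has_derivative_at_alt] that by (metis real_norm_def)
  qed
  define \<delta> where "\<delta> = min r d / K"
  have \<delta>: "\<delta> > 0" using r(1) d K by (simp add: \<delta>_def)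
  show ?thesis
  proof (intro exI[of _ \<delta>] conjI allI impI \<delta>)
    fix h :: real assume h: "0 < h \<and> h < \<delta>"
    then have hK: "h * K < min r d" using K by (simp add: \<delta>_def field_simps)
    have small: "norm (s *\<^sub>R u + h' *\<^sub>R v) \<le> h * K" if "0 \<le> s" "s \<le> h" "0 \<le> h'" "h' \<le> h" for s h'
    proof -
      have "norm (s *\<^sub>R u + h' *\<^sub>R v) \<le> s * norm u + h' * norm v"
        using that by (metis abs_of_nonneg norm_scaleR norm_triangle_ineq)
      also have "\<dots> \<le> h * norm u + h * norm v" using that by (intro add_mono mult_right_mono) auto
      also have "\<dots> \<le> h * K" using h by (simp add: K_def algebra_simps)
      finally show ?thesis .
    qed
    have inS: "x + s *\<^sub>R u + h' *\<^sub>R v \<in> S" if "0 \<le> s" "s \<le> h" "0 \<le> h'" "h' \<le> h" for s h'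
      using small[OF that] hK r(2) by (auto simp: dist_norm norm_minus_commute add.assoc subset_iff)
    define \<phi> where "\<phi> s = f (x + s *\<^sub>R u + h *\<^sub>R v) - f (x + s *\<^sub>R u)" for s
    have "(\<phi> has_real_derivative f' (x + s *\<^sub>R u + h *\<^sub>R v) u - f' (x + s *\<^sub>R u) u) (at s)"
      if s: "0 \<le> s" "s \<le> h" for s
    proof -
      have 1: "x + s *\<^sub>R u + h *\<^sub>R v \<in> S" and 2: "x + s *\<^sub>R u \<in> S"
        using inS[OF s, of h] inS[OF s, of 0] h by auto
      have l: "linear (f' (x + s *\<^sub>R u + h *\<^sub>R v))" "linear (f' (x + s *\<^sub>R u))"
        using f[OF 1] f[OF 2] by (auto dest: has_derivative_linear)
      have "((\<lambda>s. f (x + s *\<^sub>R u + h *\<^sub>R v)) has_derivative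
          (\<lambda>k. f' (x + s *\<^sub>R u + h *\<^sub>R v) (k *\<^sub>R u))) (at s)"
        by (rule has_derivative_compose[of "\<lambda>s. x + s *\<^sub>R u + h *\<^sub>R v" "\<lambda>k. k *\<^sub>R u", OF _ f[OF 1]]) (auto intro!: derivative_eq_intros)
      moreover have "((\<lambda>s. f (x + s *\<^sub>R u)) has_derivative (\<lambda>k. f' (x + s *\<^sub>R u) (k *\<^sub>R u))) (at s)"
        by (rule has_derivative_compose[of "\<lambda>s. x + s *\<^sub>R u" "\<lambda>k. k *\<^sub>R u", OF _ f[OF 2]]) (auto intro!: derivative_eq_intros)
      ultimately show ?thesis
        unfolding \<phi>_def has_field_derivative_def
        by (rule has_derivative_eq_rhs[OF has_derivative_diff])
          (auto simp: linear_scale[OF l(1)] linear_scale[OF l(2)] fun_eq_iff right_diff_distrib left_diff_distrib mult.commute)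
    qed
    then obtain \<xi> where \<xi>: "0 < \<xi>" "\<xi> < h" and
      mvt: "\<phi> h - \<phi> 0 = h * (f' (x + \<xi> *\<^sub>R u + h *\<^sub>R v) u - f' (x + \<xi> *\<^sub>R u) u)"
      using MVT2[of 0 h \<phi> "\<lambda>s. f' (x + s *\<^sub>R u + h *\<^sub>R v) u - f' (x + s *\<^sub>R u) u"] h by auto
    have e1: "\<bar>f' (x + \<xi> *\<^sub>R u + h *\<^sub>R v) u - f' x u - A (\<xi> *\<^sub>R u + h *\<^sub>R v)\<bar> \<le> e / 2 * h"
      and e2: "\<bar>f' (x + \<xi> *\<^sub>R u) u - f' x u - A (\<xi> *\<^sub>R u)\<bar> \<le> e / 2 * h"
    proof -
      have *: "\<bar>f' (x + \<xi> *\<^sub>R u + h' *\<^sub>R v) u - f' x u - A (\<xi> *\<^sub>R u + h' *\<^sub>R v)\<bar> \<le> e / 2 * h"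
        if h': "0 \<le> h'" "h' \<le> h" for h'
      proof -
        note s = small[OF less_imp_le[OF \<xi>(1)] less_imp_le[OF \<xi>(2)] h']
        have "\<bar>f' (x + \<xi> *\<^sub>R u + h' *\<^sub>R v) u - f' x u - A (\<xi> *\<^sub>R u + h' *\<^sub>R v)\<bar>
          \<le> (e / (2 * K)) * norm (\<xi> *\<^sub>R u + h' *\<^sub>R v)"
          using est[of "x + \<xi> *\<^sub>R u + h' *\<^sub>R v"] s hK by (simp add: add.assoc)
        also have "\<dots> \<le> (e / (2 * K)) * (h * K)" using s \<open>e > 0\<close> K by (intro mult_left_mono) auto
        finally show ?thesis using K by simp
      qed
      show "\<bar>f' (x + \<xi> *\<^sub>R u + h *\<^sub>R v) u - f' x u - A (\<xi> *\<^sub>R u + h *\<^sub>R v)\<bar> \<le> e / 2 * h"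
        using *[of h] h by simp
      show "\<bar>f' (x + \<xi> *\<^sub>R u) u - f' x u - A (\<xi> *\<^sub>R u)\<bar> \<le> e / 2 * h"
        using *[of 0] h by simp
    qed
    \<comment> \<open>By linearity of \<open>A\<close> the unknown intermediate point drops out: the
      two terms \<open>A (\<xi> *\<^sub>R u)\<close> cancel and \<open>h * A v\<close>
      remains.\<close>
    have "\<bar>f' (x + \<xi> *\<^sub>R u + h *\<^sub>R v) u - f' (x + \<xi> *\<^sub>R u) u - h * A v\<bar> \<le> e * h"
      using e1 e2 unfolding A.add A.scaleR real_scaleR_def by (simp only: abs_le_iff) linarith
    then have "h * \<bar>f' (x + \<xi> *\<^sub>R u + h *\<^sub>R v) u - f' (x + \<xi> *\<^sub>R u) u - h * A v\<bar> \<le> h * (e * h)"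
      using h by (intro mult_left_mono) auto
    moreover have "h * \<bar>f' (x + \<xi> *\<^sub>R u + h *\<^sub>R v) u - f' (x + \<xi> *\<^sub>R u) u - h * A v\<bar> =
        \<bar>\<phi> h - \<phi> 0 - h\<^sup>2 * A v\<bar>"
    proof -
      have "\<phi> h - \<phi> 0 - h\<^sup>2 * A v = h * (f' (x + \<xi> *\<^sub>R u + h *\<^sub>R v) u - f' (x + \<xi> *\<^sub>R u) u - h * A v)"
        unfolding mvt by (simp add: algebra_simps power2_eq_square)
      then show ?thesis using h by (simp add: abs_mult)
    qed
    ultimately show "\<bar>f (x + h *\<^sub>R u + h *\<^sub>R v) - f (x + h *\<^sub>R u) - f (x + h *\<^sub>R v) + f x - h\<^sup>2 * A v\<bar> \<le> e * h\<^sup>2"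
      by (simp add: \<phi>_def algebra_simps power2_eq_square)
  qed
qed

text \<open>The second difference is symmetric in \<open>u\<close> and \<open>v\<close>, so divided
  by the square of \<open>h\<close> it tends both to \<open>A v\<close> and to
  \<open>B u\<close>.\<close>

lemma second_derivative_symmetric_real:
  fixes f :: "'a::real_normed_vector \<Rightarrow> real"
  assumes S: "open S" "x \<in> S" and f: "\<And>y. y \<in> S \<Longrightarrow> (f has_derivative f' y) (at y)"
    and A: "((\<lambda>y. f' y u) has_derivative A) (at x)"
    and B: "((\<lambda>y. f' y v) has_derivative B) (at x)"
  shows "A v = B u"
proof (rule ccontr)
  assume "A v \<noteq> B u"
  \<comment> \<open>With a third of the gap, the two errors add up to two thirds of it, less than
    the gap itself.\<close>
  define e where "e = \<bar>A v - B u\<bar> / 3"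
  have e: "e > 0" using \<open>A v \<noteq> B u\<close> by (simp add: e_def)
  obtain d1 where d1: "d1 > 0" "\<And>h. 0 < h \<Longrightarrow> h < d1 \<Longrightarrow>
    \<bar>f (x + h *\<^sub>R u + h *\<^sub>R v) - f (x + h *\<^sub>R u) - f (x + h *\<^sub>R v) + f x - h\<^sup>2 * A v\<bar> \<le> e * h\<^sup>2"
    using second_difference_estimate[OF S f A e, of v] by blast
  obtain d2 where d2: "d2 > 0" "\<And>h. 0 < h \<Longrightarrow> h < d2 \<Longrightarrow>
    \<bar>f (x + h *\<^sub>R v + h *\<^sub>R u) - f (x + h *\<^sub>R v) - f (x + h *\<^sub>R u) + f x - h\<^sup>2 * B u\<bar> \<le> e * h\<^sup>2"
    using second_difference_estimate[OF S f B e, of u] by blast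
  define h where "h = min d1 d2 / 2"
  have h: "0 < h" "h < d1" "h < d2" using d1 d2 by (auto simp: h_def)
  have "\<bar>h\<^sup>2 * A v - h\<^sup>2 * B u\<bar> \<le> 2 * e * h\<^sup>2"
    using d1(2)[of h] d2(2)[of h] h by (simp add: algebra_simps)
  then have "h\<^sup>2 * \<bar>A v - B u\<bar> \<le> h\<^sup>2 * (2 * e)"
    by (metis abs_mult abs_power2 mult.commute mult.left_commute right_diff_distrib)
  then show False using h e by (simp add: e_def)
qed

lemma second_derivative_symmetric:
  fixes f :: "'a::real_normed_vector \<Rightarrow> 'b::real_inner"
  assumes S: "open S" "x \<in> S" and f: "\<And>y. y \<in> S \<Longrightarrow> (f has_derivative f' y) (at y)"
    and A: "((\<lambda>y. f' y u) has_derivative A) (at x)"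
    and B: "((\<lambda>y. f' y v) has_derivative B) (at x)"
  shows "A v = B u"
proof -
  have "A v \<bullet> b = B u \<bullet> b" for b
    by (rule second_derivative_symmetric_real[OF S, of "\<lambda>y. f y \<bullet> b" "\<lambda>y k. f' y k \<bullet> b"
          u "\<lambda>k. A k \<bullet> b" v "\<lambda>k. B k \<bullet> b"])
      (auto intro!: derivative_intros f A B)
  then show ?thesis by (metis inner_eq_zero_iff inner_diff_left right_minus_eq)
qed

section \<open>Local existence of integral curves in Euclidean space\<close>

text \<open>Banach's fixed point theorem for the Picard operator. Time is clamped to
  \<open>[-T, T]\<close>, so that the operator acts on the complete space of bounded continuous
  functions on the whole line.\<close>

lemma lipschitz_imp_local_flow:
  fixes g :: "'e::euclidean_space \<Rightarrow> 'e"
  assumes lip: "\<And>x y. norm (g x - g y) \<le> L * norm (x - y)"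
  obtains T x where "T > 0" "x 0 = x0" "continuous_on {-T<..<T} x"
    "\<And>t. t \<in> {-T<..<T} \<Longrightarrow> (x has_vector_derivative g (x t)) (at t)"
proof -
  define K where "K = max L 1"
  have K: "K > 0" by (simp add: K_def)
  have lipK: "norm (g x - g y) \<le> K * norm (x - y)" for x y
    using lip[of x y] mult_right_mono[of L K "norm (x - y)"] by (simp add: K_def)
  have gcont: "continuous_on UNIV g"
    by (rule lipschitz_on_continuous_on[of K], rule lipschitz_onI)
      (use lipK K in \<open>auto simp: dist_norm\<close>)
  \<comment> \<open>The integrals run over an interval of length at most \<open>2 * T\<close>, so
    each contributes the Lipschitz factor \<open>2 * T * K = 1/4\<close>; \<open>P\<close> contains
    two of them, which makes it a contraction with constant 1/2.\<close>
  define T where "T = 1 / (8 * K)"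
  have T: "T > 0" using K by (simp add: T_def)
  \<comment> \<open>Integrating from \<open>-T\<close> treats both signs of \<open>t\<close> alike;
    subtracting \<open>J \<phi> 0\<close> in \<open>P\<close> restores the initial value at time
    0.\<close>
  define J where "J \<phi> t = integral {-T..t} (\<lambda>s. g (apply_bcontfun \<phi> s))" for \<phi> :: "real \<Rightarrow>\<^sub>C 'e" and t :: real
  define cl where "cl t = max (-T) (min T t)" for t :: real
  define P where "P \<phi> t = x0 + J \<phi> (cl t) - J \<phi> 0" for \<phi> t
  have cont: "continuous_on X (\<lambda>s. g (apply_bcontfun \<phi> s))" for \<phi> :: "real \<Rightarrow>\<^sub>C 'e" and X
    by (rule continuous_on_compose2[OF gcont]) auto
  have int: "(\<lambda>s. g (apply_bcontfun \<phi> s)) integrable_on {a..b}" for \<phi> :: "real \<Rightarrow>\<^sub>C 'e" and a b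
    by (rule integrable_continuous_real[OF cont])
  have Jd: "(J \<phi> has_vector_derivative g (apply_bcontfun \<phi> t)) (at t within {-T..T})"
    if "t \<in> {-T..T}" for \<phi> t
    unfolding J_def by (rule integral_has_vector_derivative[OF cont that])
  have cl_in: "cl t \<in> {-T..T}" for t using T by (auto simp: cl_def)
  have clcont: "continuous_on UNIV cl" unfolding cl_def by (intro continuous_intros)
  have Jcont: "continuous_on {-T..T} (J \<phi>)" for \<phi>
    unfolding continuous_on_eq_continuous_within
    using has_vector_derivative_continuous[OF Jd] by blast
  have "P \<phi> \<in> bcontfun" for \<phi>
  proof -
    have "compact (J \<phi> ` {-T..T})" by (rule compact_continuous_image[OF Jcont]) simp
    then obtain B where B: "\<And>t. t \<in> {-T..T} \<Longrightarrow> norm (J \<phi> t) \<le> B"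
      by (metis bounded_iff compact_imp_bounded image_eqI)
    show ?thesis
    proof (rule bcontfun_normI)
      show "continuous_on UNIV (P \<phi>)"
        unfolding P_def
        by (intro continuous_intros continuous_on_compose2[OF Jcont clcont]) (use cl_in in auto)
      show "norm (P \<phi> t) \<le> norm x0 + B + B" for t
        unfolding P_def using B[OF cl_in[of t]] B[of 0] T
          norm_triangle_ineq4[of "x0 + J \<phi> (cl t)" "J \<phi> 0"] norm_triangle_ineq[of x0 "J \<phi> (cl t)"]
        by simp
    qed
  qed
  then have Papp: "apply_bcontfun (Bcontfun (P \<phi>)) = P \<phi>" for \<phi>
    by (rule Bcontfun_inverse)
  have Jdist: "norm (J \<phi> t - J \<psi> t) \<le> 1/4 * dist \<phi> \<psi>" if t: "t \<in> {-T..T}" for \<phi> \<psi> t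
  proof -
    have "J \<phi> t - J \<psi> t = integral {-T..t} (\<lambda>s. g (apply_bcontfun \<phi> s) - g (apply_bcontfun \<psi> s))"
      unfolding J_def by (rule integral_diff[symmetric]) (rule int)+
    also have "norm \<dots> \<le> integral {-T..t} (\<lambda>s. K * dist \<phi> \<psi>)"
    proof (rule integral_norm_bound_integral)
      show "norm (g (apply_bcontfun \<phi> s) - g (apply_bcontfun \<psi> s)) \<le> K * dist \<phi> \<psi>" for s
        using lipK[of "apply_bcontfun \<phi> s" "apply_bcontfun \<psi> s"] K dist_bounded[of \<phi> s \<psi>]
        by (metis dist_norm mult_le_cancel_left_pos order_trans)
    qed (auto intro!: integrable_diff int)
    also have "\<dots> = (t + T) * (K * dist \<phi> \<psi>)" using t by simp
    also have "\<dots> \<le> (2 * T) * (K * dist \<phi> \<psi>)" using t K by (intro mult_right_mono) auto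
    also have "\<dots> = 1/4 * dist \<phi> \<psi>" using K by (simp add: T_def)
    finally show ?thesis .
  qed
  have "\<exists>!\<phi>. Bcontfun (P \<phi>) = \<phi>"
  proof (rule banach_fix_type[of "1/2"])
    show "\<forall>\<phi> \<psi>. dist (Bcontfun (P \<phi>)) (Bcontfun (P \<psi>)) \<le> 1 / 2 * dist \<phi> \<psi>"
    proof (intro allI dist_bound, unfold Papp)
      fix \<phi> \<psi> t
      have "dist (P \<phi> t) (P \<psi> t) = norm ((J \<phi> (cl t) - J \<psi> (cl t)) - (J \<phi> 0 - J \<psi> 0))"
        by (simp add: P_def dist_norm algebra_simps)
      also have "\<dots> \<le> norm (J \<phi> (cl t) - J \<psi> (cl t)) + norm (J \<phi> 0 - J \<psi> 0)"
        by (rule norm_triangle_ineq4)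
      also have "\<dots> \<le> 1 / 2 * dist \<phi> \<psi>"
        using Jdist[OF cl_in[of t], of \<phi> \<psi>] Jdist[of 0 \<phi> \<psi>] T by simp
      finally show "dist (P \<phi> t) (P \<psi> t) \<le> 1 / 2 * dist \<phi> \<psi>" .
    qed
  qed auto
  then obtain \<phi> where "Bcontfun (P \<phi>) = \<phi>" by blast
  then have fp: "apply_bcontfun \<phi> t = P \<phi> t" for t by (metis Papp)
  show ?thesis
  proof (rule that[OF T])
    show "apply_bcontfun \<phi> 0 = x0" using T by (simp add: fp P_def cl_def)
    show "continuous_on {-T<..<T} (apply_bcontfun \<phi>)" by simp
    fix t assume t: "t \<in> {-T<..<T}"
    then have "(J \<phi> has_vector_derivative g (apply_bcontfun \<phi> t)) (at t)"
      using Jd[of t \<phi>] by (simp add: at_within_Icc_at)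
    then have "((\<lambda>t. x0 + J \<phi> t - J \<phi> 0) has_vector_derivative g (apply_bcontfun \<phi> t)) (at t)"
      by (auto intro!: derivative_eq_intros)
    then show "(apply_bcontfun \<phi> has_vector_derivative g (apply_bcontfun \<phi> t)) (at t)"
      by (rule has_vector_derivative_transform_within_open[of _ _ _ "{-T<..<T}"])
        (use t in \<open>auto simp: fp P_def cl_def\<close>)
  qed
qed

text \<open>Precomposing with the nearest-point projection onto the ball gives a globally Lipschitz
  field. Its solution stays in the ball for a short time by continuity, and there the projection is
  the identity.\<close>

lemma locally_lipschitz_imp_local_flow:
  fixes F :: "'e::euclidean_space \<Rightarrow> 'e"
  assumes r: "r > 0"
    and lip: "\<And>x y. x \<in> cball x0 r \<Longrightarrow> y \<in> cball x0 r \<Longrightarrow> norm (F x - F y) \<le> L * norm (x - y)"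
  obtains T x where "T > 0" "x 0 = x0"
    "\<And>t. t \<in> {-T<..<T} \<Longrightarrow> x t \<in> cball x0 r"
    "\<And>t. t \<in> {-T<..<T} \<Longrightarrow> (x has_vector_derivative F (x t)) (at t)"
proof -
  define pr where "pr = closest_point (cball x0 r)"
  have ball: "closed (cball x0 r)" "cball x0 r \<noteq> {}" "convex (cball x0 r)" using r by auto
  have pr_in: "pr x \<in> cball x0 r" for x
    unfolding pr_def using closest_point_in_set[OF ball(1,2)] .
  have "norm (F (pr x) - F (pr y)) \<le> \<bar>L\<bar> * norm (x - y)" for x y
  proof -
    have "norm (F (pr x) - F (pr y)) \<le> L * norm (pr x - pr y)" using lip pr_in by blast
    also have "\<dots> \<le> \<bar>L\<bar> * norm (pr x - pr y)" by (intro mult_right_mono) auto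
    also have "\<dots> \<le> \<bar>L\<bar> * norm (x - y)"
      using closest_point_lipschitz[OF ball(3,1,2), of x y]
      by (intro mult_left_mono) (auto simp: pr_def dist_norm)
    finally show ?thesis .
  qed
  then obtain T x where T: "T > 0" and x: "x 0 = x0" "continuous_on {-T<..<T} x"
    "\<And>t. t \<in> {-T<..<T} \<Longrightarrow> (x has_vector_derivative F (pr (x t))) (at t)"
    using lipschitz_imp_local_flow[of "\<lambda>x. F (pr x)" "\<bar>L\<bar>" x0] by metis
  have "isCont x 0" using x(2) T by (simp add: continuous_on_eq_continuous_at)
  then obtain d where d: "d > 0" "\<And>t. \<bar>t\<bar> < d \<Longrightarrow> dist (x t) x0 < r"
    using r x(1) unfolding continuous_at_eps_delta by (metis dist_real_def diff_zero)
  have in_ball: "x t \<in> cball x0 r" if "t \<in> {- min T d <..< min T d}" for t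
    using d(2)[of t] that by (auto simp: dist_commute abs_less_iff intro: less_imp_le)
  show ?thesis
  proof (rule that[of "min T d" x])
    fix t assume t: "t \<in> {- min T d <..< min T d}"
    show "(x has_vector_derivative F (x t)) (at t)"
      using x(3)[of t] closest_point_self[OF in_ball[OF t]] t
      unfolding pr_def greaterThanLessThan_iff by (metis min_less_iff_conj neg_less_iff_less minus_less_iff)
  qed (use T d x in_ball in auto)
qed

lemma Ck_on_1_has_derivative:
  assumes "Ck_on (Suc k) S f" "x \<in> S"
  shows "(f has_derivative frechet_derivative f (at x)) (at x)"
  using assms by (simp add: frechet_derivative_works[symmetric])

text \<open>Compactness of a closed ball bounds the derivative on each basis vector, hence its
  operator norm; the mean value inequality on the convex ball does the rest.\<close>

lemma Ck_on_1_locally_lipschitz: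
  fixes f :: "'e::euclidean_space \<Rightarrow> 'f::real_normed_vector"
  assumes f: "Ck_on (Suc 0) S f" and S: "open S" "x \<in> S"
  obtains r L where "r > 0" "cball x r \<subseteq> S" "L \<ge> 0"
    "\<And>y z. y \<in> cball x r \<Longrightarrow> z \<in> cball x r \<Longrightarrow> norm (f y - f z) \<le> L * norm (y - z)"
proof -
  obtain r where r: "r > 0" "cball x r \<subseteq> S" using S open_contains_cball by blast
  let ?D = "\<lambda>y. frechet_derivative f (at y)"
  have "\<exists>B. \<forall>y\<in>cball x r. norm (?D y b) \<le> B" for b
  proof -
    have "continuous_on (cball x r) (\<lambda>y. ?D y b)"
      using f r(2) by (auto intro: continuous_on_subset)
    then have "bounded ((\<lambda>y. ?D y b) ` cball x r)"
      by (intro compact_imp_bounded compact_continuous_image) auto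
    then show ?thesis by (auto simp: bounded_iff)
  qed
  then obtain B where B: "\<And>b y. y \<in> cball x r \<Longrightarrow> norm (?D y b) \<le> B b" by metis
  define L where "L = (\<Sum>b\<in>Basis. \<bar>B b\<bar>)"
  have der: "(f has_derivative ?D y) (at y)" if "y \<in> cball x r" for y
    using Ck_on_1_has_derivative[OF f] that r(2) by auto
  have on: "onorm (?D y) \<le> L" if y: "y \<in> cball x r" for y
  proof (rule onorm_le)
    fix v
    have lin: "linear (?D y)" using der[OF y] by (rule has_derivative_linear)
    have "?D y v = (\<Sum>b\<in>Basis. (v \<bullet> b) *\<^sub>R ?D y b)"
      by (subst euclidean_representation[of v, symmetric])
        (simp add: linear_sum[OF lin] linear_scale[OF lin])
    also have "norm \<dots> \<le> (\<Sum>b\<in>Basis. norm v * \<bar>B b\<bar>)"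
    proof (rule sum_norm_le)
      fix b :: 'e assume "b \<in> Basis"
      then show "norm ((v \<bullet> b) *\<^sub>R ?D y b) \<le> norm v * \<bar>B b\<bar>"
        using B[OF y, of b] by (auto intro!: mult_mono Basis_le_norm)
    qed
    finally show "norm (?D y v) \<le> L * norm v" by (simp add: L_def sum_distrib_left mult.commute)
  qed
  show ?thesis
  proof (rule that[OF r])
    show "L \<ge> 0" by (simp add: L_def sum_nonneg)
    show "norm (f y - f z) \<le> L * norm (y - z)" if "y \<in> cball x r" "z \<in> cball x r" for y z
      by (rule differentiable_bound[of "cball x r" f ?D])
        (use that on der in \<open>auto intro: has_derivative_at_withinI\<close>)
  qed
qed


section \<open>Tangent vectors in charts\<close>

lemma chart_inv_in_dom: "x \<in> chart_img c \<Longrightarrow> chart_inv c x \<in> chart_dom c"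
  by (auto simp: chart_img_def chart_inv_def inv_into_into)

lemma chart_map_inv: "x \<in> chart_img c \<Longrightarrow> chart_map c (chart_inv c x) = x"
  by (simp add: chart_img_def chart_inv_def f_inv_into_f)

lemma chart_at_in:
  assumes "p \<in> carrier A"
  shows "chart_at A p \<in> charts_at A p"
proof -
  have "\<exists>c. c \<in> charts_at A p" using assms by (auto simp: carrier_def charts_at_def)
  then show ?thesis unfolding chart_at_def by (rule someI_ex)
qed

lemma has_derivative_comp_fst:
  assumes "(f has_derivative f') (at (fst y))"
  shows "((\<lambda>y. f (fst y)) has_derivative (\<lambda>w. f' (fst w))) (at y)"
  using has_derivative_compose[OF has_derivative_fst[OF has_derivative_ident] assms] .

text \<open>The first-order calculus shared by \<open>Q\<close> and \<open>T*Q\<close>. Transitions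
  of lifted charts contain derivatives of transitions of \<open>Q\<close>, so asking for mere
  differentiability keeps the verification for \<open>cotangent_atlas\<close> to two derivatives on
  \<open>Q\<close>.\<close>

locale differentiable_atlas =
  fixes A :: "('a, 'e::euclidean_space) chart set"
  assumes inj_chart: "c \<in> A \<Longrightarrow> inj_on (chart_map c) (chart_dom c)"
    and open_overlap: "c \<in> A \<Longrightarrow> d \<in> A \<Longrightarrow> open (chart_map c ` (chart_dom c \<inter> chart_dom d))"
    and transition_differentiable: "c \<in> A \<Longrightarrow> d \<in> A \<Longrightarrow> q \<in> chart_dom c \<Longrightarrow> q \<in> chart_dom d \<Longrightarrow>
      transition c d differentiable (at (chart_map c q))"
begin

definition Dtrans :: "('a, 'e) chart \<Rightarrow> ('a, 'e) chart \<Rightarrow> 'a \<Rightarrow> 'e \<Rightarrow> 'e" where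
  "Dtrans c d q = frechet_derivative (transition c d) (at (chart_map c q))"

lemma chart_inv_map [simp]:
  "c \<in> A \<Longrightarrow> q \<in> chart_dom c \<Longrightarrow> chart_inv c (chart_map c q) = q"
  by (simp add: chart_inv_def inj_chart)

lemma open_chart_img: "c \<in> A \<Longrightarrow> open (chart_img c)"
  using open_overlap[of c c] by (simp add: chart_img_def)

lemma transition_map [simp]:
  "c \<in> A \<Longrightarrow> q \<in> chart_dom c \<Longrightarrow> transition c d (chart_map c q) = chart_map d q"
  by (simp add: transition_def)

lemma transition_has_derivative:
  assumes "c \<in> charts_at A q" "d \<in> charts_at A q"
  shows "(transition c d has_derivative Dtrans c d q) (at (chart_map c q))"
  using transition_differentiable assms
  unfolding Dtrans_def charts_at_def by (auto simp: frechet_derivative_works[symmetric])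

lemma linear_Dtrans: "c \<in> charts_at A q \<Longrightarrow> d \<in> charts_at A q \<Longrightarrow> linear (Dtrans c d q)"
  using transition_has_derivative has_derivative_linear by blast

lemma Dtrans_cocycle:
  assumes c: "c \<in> charts_at A q" and d: "d \<in> charts_at A q" and k: "k \<in> charts_at A q"
  shows "Dtrans d k q (Dtrans c d q u) = Dtrans c k q u"
proof -
  have cA: "c \<in> A" "q \<in> chart_dom c" "d \<in> A" "q \<in> chart_dom d"
    using c d by (auto simp: charts_at_def)
  have "((\<lambda>x. transition d k (transition c d x)) has_derivative (\<lambda>u. Dtrans d k q (Dtrans c d q u)))
      (at (chart_map c q))"
    using has_derivative_compose[OF transition_has_derivative[OF c d], of "transition d k"]
      transition_has_derivative[OF d k] cA by simp
  then have "(transition c k has_derivative (\<lambda>u. Dtrans d k q (Dtrans c d q u))) (at (chart_map c q))"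
    by (rule has_derivative_transform_within_open[OF _ open_overlap[OF cA(1,3)]])
      (use cA in \<open>auto simp: transition_def\<close>)
  from has_derivative_unique[OF this transition_has_derivative[OF c k]]
  show ?thesis by (rule fun_cong)
qed

lemma Dtrans_same:
  assumes c: "c \<in> charts_at A q"
  shows "Dtrans c c q u = u"
proof -
  have cA: "c \<in> A" "q \<in> chart_dom c" using c by (auto simp: charts_at_def)
  have "(transition c c has_derivative (\<lambda>u. u)) (at (chart_map c q))"
    by (rule has_derivative_transform_within_open[OF has_derivative_ident open_chart_img[OF cA(1)]])
      (use cA in \<open>auto simp: transition_def chart_map_inv chart_img_def\<close>)
  from has_derivative_unique[OF transition_has_derivative[OF c c] this]
  show ?thesis by (rule fun_cong)
qed

lemma coord_tvec_apply:
  "coord_tvec A c q u d = (if d \<in> charts_at A q then Dtrans c d q u else 0)"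
  by (simp add: coord_tvec_def Dtrans_def)

lemma coord_tvec_self: "c \<in> charts_at A q \<Longrightarrow> coord_tvec A c q u c = u"
  by (simp add: coord_tvec_apply Dtrans_same)

lemma tangent_space_iff:
  "v \<in> tangent_space A q \<longleftrightarrow> (\<forall>c. c \<notin> charts_at A q \<longrightarrow> v c = 0) \<and>
     (\<forall>c\<in>charts_at A q. \<forall>d\<in>charts_at A q. v d = Dtrans c d q (v c))"
  by (simp add: tangent_space_def Dtrans_def)

lemma coord_tvec_in_tangent_space:
  "c \<in> charts_at A q \<Longrightarrow> coord_tvec A c q u \<in> tangent_space A q"
  by (simp add: tangent_space_iff coord_tvec_apply Dtrans_cocycle)

lemma tangent_change:
  "v \<in> tangent_space A q \<Longrightarrow> c \<in> charts_at A q \<Longrightarrow> d \<in> charts_at A q \<Longrightarrow> v d = Dtrans c d q (v c)"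
  unfolding tangent_space_iff by blast

lemma tangent_eq_coord_tvec:
  assumes v: "v \<in> tangent_space A q" and c: "c \<in> charts_at A q"
  shows "coord_tvec A c q (v c) = v"
proof
  fix d
  show "coord_tvec A c q (v c) d = v d"
  proof (cases "d \<in> charts_at A q")
    case True
    then show ?thesis by (simp add: coord_tvec_apply tangent_change[OF v c True, symmetric])
  next
    case False
    with v have "v d = 0" unfolding tangent_space_iff by blast
    with False show ?thesis by (simp add: coord_tvec_apply)
  qed
qed

lemma coord_tvec_change:
  "c \<in> charts_at A q \<Longrightarrow> d \<in> charts_at A q \<Longrightarrow> coord_tvec A d q (Dtrans c d q u) = coord_tvec A c q u"
  by (auto simp: fun_eq_iff coord_tvec_apply Dtrans_cocycle)

lemma coord_tvec_linear:
  "c \<in> charts_at A q \<Longrightarrow> coord_tvec A c q (a *\<^sub>R u + b *\<^sub>R v) =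
    (\<lambda>d. a *\<^sub>R coord_tvec A c q u d + b *\<^sub>R coord_tvec A c q v d)"
  using linear_Dtrans by (auto simp: fun_eq_iff coord_tvec_apply linear_add linear_scale)

text \<open>Frees \<open>d0\<close> from the chart picked by \<open>chart_at\<close>: the chain rule
  along the transition from that chart to \<open>c\<close> turns the components \<open>v k\<close>
  into \<open>v c\<close>.\<close>

lemma d0_in_chart:
  assumes c: "c \<in> charts_at A q" and v: "v \<in> tangent_space A q"
    and f: "(f \<circ> chart_inv c has_derivative f') (at (chart_map c q))"
  shows "d0 A f q v = f' (v c)"
proof -
  define k where "k = chart_at A q"
  have k: "k \<in> charts_at A q"
    unfolding k_def by (rule chart_at_in) (use c in \<open>auto simp: carrier_def charts_at_def\<close>)
  have cA: "c \<in> A" "q \<in> chart_dom c" "k \<in> A" "q \<in> chart_dom k"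
    using c k by (auto simp: charts_at_def)
  have "((\<lambda>x. (f \<circ> chart_inv c) (transition k c x)) has_derivative (\<lambda>u. f' (Dtrans k c q u)))
      (at (chart_map k q))"
    using has_derivative_compose[OF transition_has_derivative[OF k c], of "f \<circ> chart_inv c"] f cA
    by simp
  then have "(f \<circ> chart_inv k has_derivative (\<lambda>u. f' (Dtrans k c q u))) (at (chart_map k q))"
    by (rule has_derivative_transform_within_open[OF _ open_overlap[OF cA(3,1)]])
      (use cA in \<open>auto simp: transition_def\<close>)
  then show ?thesis
    by (simp add: d0_def Let_def k_def[symmetric] frechet_derivative_at[symmetric] tangent_change[OF v k c])
qed

text \<open>A single chart suffices: continuity keeps the curve in the overlap with any other chart,
  and the derivative of the transition carries the velocity over as it carries tangent
  vectors.\<close>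

lemma has_velocityI:
  assumes c: "c \<in> charts_at A (\<gamma> t)" and v: "v \<in> tangent_space A (\<gamma> t)"
    and ev: "\<forall>\<^sub>F s in at t. \<gamma> s \<in> chart_dom c"
    and der: "((chart_map c \<circ> \<gamma>) has_vector_derivative v c) (at t)"
  shows "has_velocity A \<gamma> v t"
  unfolding has_velocity_def
proof (intro conjI ballI)
  show "\<gamma> t \<in> carrier A" using c by (auto simp: carrier_def charts_at_def)
  fix d assume d: "d \<in> charts_at A (\<gamma> t)"
  have cA: "c \<in> A" "\<gamma> t \<in> chart_dom c" "d \<in> A" "\<gamma> t \<in> chart_dom d"
    using c d by (auto simp: charts_at_def)
  have "isCont (chart_map c \<circ> \<gamma>) t"
    using has_vector_derivative_continuous[OF der] .
  then have "((chart_map c \<circ> \<gamma>) \<longlongrightarrow> chart_map c (\<gamma> t)) (at t)" by (simp add: isCont_def)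
  then have "\<forall>\<^sub>F s in at t. (chart_map c \<circ> \<gamma>) s \<in> chart_map c ` (chart_dom c \<inter> chart_dom d)"
    by (rule topological_tendstoD[OF _ open_overlap]) (use cA in auto)
  then show evd: "\<forall>\<^sub>F s in at t. \<gamma> s \<in> chart_dom d"
    using ev by eventually_elim (use inj_chart[OF cA(1)] in \<open>auto simp: inj_on_def\<close>)
  have "((transition c d \<circ> (chart_map c \<circ> \<gamma>)) has_vector_derivative Dtrans c d (\<gamma> t) (v c)) (at t)"
    using vector_derivative_diff_chain_within[OF der has_derivative_at_withinI, of "transition c d"]
      transition_has_derivative[OF c d] by simp
  then have "((transition c d \<circ> (chart_map c \<circ> \<gamma>)) has_vector_derivative v d) (at t)"
    by (simp only: tangent_change[OF v c d])
  moreover have "\<forall>\<^sub>F s in at t. (transition c d \<circ> (chart_map c \<circ> \<gamma>)) s = (chart_map d \<circ> \<gamma>) s"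
    using ev by eventually_elim (use cA in simp)
  ultimately show "((chart_map d \<circ> \<gamma>) has_vector_derivative v d) (at t)"
    unfolding has_vector_derivative_def
    by (rule has_derivative_transform_eventually) (use cA in auto)
qed (rule v)

end

locale atlas =
  fixes A :: "('a, 'e::euclidean_space) chart set"
  assumes smooth: "smooth_atlas A"
begin

lemma Ck_transition:
  "c \<in> A \<Longrightarrow> d \<in> A \<Longrightarrow> Ck_on k (chart_map c ` (chart_dom c \<inter> chart_dom d)) (transition c d)"
  using smooth by (auto simp: smooth_atlas_def smooth_on_def)

sublocale differentiable_atlas A
proof
  fix c d assume *: "c \<in> A" "d \<in> A"
  show "inj_on (chart_map c) (chart_dom c)" using * smooth by (auto simp: smooth_atlas_def)
  show "open (chart_map c ` (chart_dom c \<inter> chart_dom d))" using * smooth by (auto simp: smooth_atlas_def)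
  show "transition c d differentiable (at (chart_map c q))"
    if "q \<in> chart_dom c" "q \<in> chart_dom d" for q
    using Ck_transition[OF *, of "Suc 0"] that by auto
qed

lemma Dtrans_differentiable:
  assumes c: "c \<in> charts_at A q" and d: "d \<in> charts_at A q"
  shows "(\<lambda>x. frechet_derivative (transition c d) (at x) u) differentiable (at (chart_map c q))"
  using Ck_transition[of c d "Suc (Suc 0)"] c d by (auto simp: charts_at_def)

subsection \<open>The cotangent bundle\<close>

definition momentum :: "('a, 'e) chart \<Rightarrow> 'a \<Rightarrow> (('a, 'e) tvec \<Rightarrow> real) \<Rightarrow> 'e" where
  "momentum c q \<xi> = (\<Sum>b\<in>Basis. \<xi> (coord_tvec A c q b) *\<^sub>R b)"

abbreviation lift :: "('a, 'e) chart \<Rightarrow> (('a, 'e) covec, 'e \<times> 'e) chart" where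
  "lift \<equiv> cotangent_chart A"

lemma lift_dom: "z \<in> chart_dom (lift c) \<longleftrightarrow> fst z \<in> chart_dom c \<and> snd z \<in> cotangent_space A (fst z)"
  by (cases z) (simp add: cotangent_chart_def)

lemma lift_map: "chart_map (lift c) z = (chart_map c (fst z), momentum c (fst z) (snd z))"
  by (simp add: cotangent_chart_def momentum_def split_beta)

lemma cotangent_apply_linear:
  assumes \<xi>: "\<xi> \<in> cotangent_space A q" and c: "c \<in> charts_at A q"
  shows "linear (\<lambda>u. \<xi> (coord_tvec A c q u))"
proof -
  have *: "\<xi> (coord_tvec A c q (a *\<^sub>R u + b *\<^sub>R v)) =
      a * \<xi> (coord_tvec A c q u) + b * \<xi> (coord_tvec A c q v)" for a b u v
    unfolding coord_tvec_linear[OF c]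
    using \<xi> coord_tvec_in_tangent_space[OF c] by (simp add: cotangent_space_def)
  show ?thesis
    by (rule linearI) (use *[of 1 _ 1] *[of _ _ 0] in auto)
qed

lemma cotangent_apply:
  assumes \<xi>: "\<xi> \<in> cotangent_space A q" and c: "c \<in> charts_at A q"
  shows "\<xi> (coord_tvec A c q u) = momentum c q \<xi> \<bullet> u"
proof -
  interpret linear "\<lambda>u. \<xi> (coord_tvec A c q u)" by (rule cotangent_apply_linear[OF \<xi> c])
  have "\<xi> (coord_tvec A c q u) = \<xi> (coord_tvec A c q (\<Sum>b\<in>Basis. (u \<bullet> b) *\<^sub>R b))"
    by (simp add: euclidean_representation)
  also have "\<dots> = momentum c q \<xi> \<bullet> u"
    by (simp add: sum scale momentum_def inner_sum_right inner_commute[of _ u] mult.commute)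
  finally show ?thesis .
qed

lemma momentum_inj:
  assumes "\<xi> \<in> cotangent_space A q" "\<eta> \<in> cotangent_space A q" and c: "c \<in> charts_at A q"
    and "momentum c q \<xi> = momentum c q \<eta>"
  shows "\<xi> = \<eta>"
proof (rule extensionalityI[where A = "tangent_space A q"])
  fix v assume "v \<in> tangent_space A q"
  from tangent_eq_coord_tvec[OF this c] show "\<xi> v = \<eta> v"
    using cotangent_apply[OF assms(1) c, of "v c"] cotangent_apply[OF assms(2) c, of "v c"] assms(4)
    by simp
qed (use assms in \<open>auto simp: cotangent_space_def\<close>)

lemma momentum_surj:
  assumes c: "c \<in> charts_at A q"
  obtains \<xi> where "\<xi> \<in> cotangent_space A q" "momentum c q \<xi> = p"
proof
  \<comment> \<open>Covectors are required to be \<open>extensional\<close>, hence the restriction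
    to the tangent space.\<close>
  let ?\<xi> = "restrict (\<lambda>v. p \<bullet> v c) (tangent_space A q)"
  have "(\<lambda>d. a *\<^sub>R u d + b *\<^sub>R v d) \<in> tangent_space A q"
    if "u \<in> tangent_space A q" "v \<in> tangent_space A q" for a b u v
  proof -
    have "coord_tvec A c q (a *\<^sub>R u c + b *\<^sub>R v c) = (\<lambda>d. a *\<^sub>R u d + b *\<^sub>R v d)"
      unfolding coord_tvec_linear[OF c] using that by (simp add: tangent_eq_coord_tvec c)
    then show ?thesis using coord_tvec_in_tangent_space[OF c] by metis
  qed
  then show "?\<xi> \<in> cotangent_space A q"
    by (auto simp: cotangent_space_def inner_right_distrib)
  show "momentum c q ?\<xi> = p"
    by (simp add: momentum_def coord_tvec_in_tangent_space[OF c] coord_tvec_self[OF c] euclidean_representation)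
qed

text \<open>Coordinate vectors of \<open>d\<close> have components \<open>Dtrans d c q b\<close> in
  \<open>c\<close>, so momenta transform by the transpose of the derivative taken backwards, from
  \<open>d\<close> to \<open>c\<close>.\<close>

lemma momentum_change:
  assumes \<xi>: "\<xi> \<in> cotangent_space A q" and c: "c \<in> charts_at A q" and d: "d \<in> charts_at A q"
  shows "momentum d q \<xi> = (\<Sum>b\<in>Basis. (momentum c q \<xi> \<bullet> Dtrans d c q b) *\<^sub>R b)"
  unfolding momentum_def[of d] coord_tvec_change[OF d c, symmetric] cotangent_apply[OF \<xi> c] ..

section \<open>The induced atlas of the cotangent bundle\<close>

lemma inj_on_lift: "c \<in> A \<Longrightarrow> inj_on (chart_map (lift c)) (chart_dom (lift c))"
proof (rule inj_onI)
  fix z w assume c: "c \<in> A" and z: "z \<in> chart_dom (lift c)" and w: "w \<in> chart_dom (lift c)"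
    and eq: "chart_map (lift c) z = chart_map (lift c) w"
  then have f: "fst z = fst w" using inj_chart[OF c] by (auto simp: lift_dom lift_map dest: inj_onD)
  moreover have "snd z = snd w"
    by (rule momentum_inj[of _ "fst z" _ c]) (use z w c eq f in \<open>auto simp: lift_dom lift_map charts_at_def\<close>)
  ultimately show "z = w" by (simp add: prod_eq_iff)
qed

text \<open>Every momentum occurs over every base point (\<open>momentum_surj\<close>), so the image
  is a full product; its openness reduces to that of the overlap in the base.\<close>

lemma lift_overlap_img:
  assumes c: "c \<in> A"
  shows "chart_map (lift c) ` (chart_dom (lift c) \<inter> chart_dom (lift d)) =
    chart_map c ` (chart_dom c \<inter> chart_dom d) \<times> UNIV"
proof -
  have "(chart_map c q, p) \<in> chart_map (lift c) ` (chart_dom (lift c) \<inter> chart_dom (lift d))"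
    if q: "q \<in> chart_dom c" "q \<in> chart_dom d" for q p
  proof -
    have "c \<in> charts_at A q" using c q by (simp add: charts_at_def)
    then obtain \<xi> where "\<xi> \<in> cotangent_space A q" "momentum c q \<xi> = p" by (rule momentum_surj)
    then show ?thesis using q by (intro image_eqI[of _ _ "(q, \<xi>)"]) (auto simp: lift_map lift_dom)
  qed
  then show ?thesis by (auto simp: lift_map lift_dom)
qed

lemma lift_img: "c \<in> A \<Longrightarrow> chart_img (lift c) = chart_img c \<times> UNIV"
  using lift_overlap_img[of c c] by (simp add: chart_img_def)

lemma fst_lift_inv: "c \<in> A \<Longrightarrow> y \<in> chart_img (lift c) \<Longrightarrow> fst (chart_inv (lift c) y) = chart_inv c (fst y)"
  using chart_map_inv[of y "lift c"] chart_inv_in_dom[of y "lift c"]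
  by (metis chart_inv_map fst_conv lift_dom lift_map)

lemma lift_transition:
  assumes c: "c \<in> A" and d: "d \<in> A" and z: "z \<in> chart_dom (lift c)" "z \<in> chart_dom (lift d)"
    and y: "y = chart_map (lift c) z"
  shows "transition (lift c) (lift d) y = (transition c d (fst y),
    \<Sum>b\<in>Basis. (snd y \<bullet> frechet_derivative (transition d c) (at (transition c d (fst y))) b) *\<^sub>R b)"
proof -
  have cd: "c \<in> charts_at A (fst z)" "d \<in> charts_at A (fst z)"
    using c d z by (auto simp: charts_at_def lift_dom)
  have "chart_inv (lift c) y = z"
    using inj_on_lift[OF c] z by (simp add: y chart_inv_def)
  then show ?thesis
    using momentum_change[OF _ cd] z c
    by (simp add: y transition_def[of "lift c"] lift_map lift_dom Dtrans_def)
qed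

text \<open>The base component depends on the base alone; the momentum component is linear in the
  momentum, with first derivatives of \<open>transition d c\<close> as coefficients, and these are
  differentiable again. Only the base block of the derivative is named, since
  \<open>fst_cot_Dtrans\<close> needs nothing else.\<close>

lemma lift_transition_has_derivative:
  assumes c: "c \<in> A" and d: "d \<in> A" and z: "z \<in> chart_dom (lift c)" "z \<in> chart_dom (lift d)"
  shows "\<exists>D. (transition (lift c) (lift d) has_derivative (\<lambda>w. (Dtrans c d (fst z) (fst w), D w)))
    (at (chart_map (lift c) z))"
proof -
  let ?q = "fst z" and ?y = "chart_map (lift c) z"
  have cd: "c \<in> charts_at A ?q" "d \<in> charts_at A ?q"
    using c d z by (auto simp: charts_at_def lift_dom)
  have q: "?q \<in> chart_dom c" using z by (simp add: lift_dom)
  have "((\<lambda>y. transition c d (fst y)) has_derivative (\<lambda>w. Dtrans c d ?q (fst w))) (at ?y)"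
    by (rule has_derivative_comp_fst) (use transition_has_derivative[OF cd] in \<open>simp add: lift_map\<close>)
  note 1 = this
  have "\<forall>b. \<exists>E. ((\<lambda>x. frechet_derivative (transition d c) (at x) b) has_derivative E) (at (chart_map d ?q))"
    using Dtrans_differentiable[OF cd(2,1)] by (simp add: differentiable_def)
  then obtain E where E: "\<And>b. ((\<lambda>x. frechet_derivative (transition d c) (at x) b) has_derivative E b)
      (at (chart_map d ?q))" by metis
  have E': "((\<lambda>y. frechet_derivative (transition d c) (at (transition c d (fst y))) b) has_derivative
      (\<lambda>w. E b (Dtrans c d ?q (fst w)))) (at ?y)" for b
    using has_derivative_compose[OF 1, of "\<lambda>x. frechet_derivative (transition d c) (at x) b" "E b"] E c q
    by (simp add: lift_map)
  \<comment> \<open>Product rule for the pairing: \<open>E b\<close> differentiates the coefficient,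
    and the second summand differentiates the momentum.\<close>
  define D where "D w = (\<Sum>b\<in>Basis. (snd ?y \<bullet> E b (Dtrans c d ?q (fst w)) +
      snd w \<bullet> frechet_derivative (transition d c) (at (transition c d (fst ?y))) b) *\<^sub>R b)" for w
  have 2: "((\<lambda>y. \<Sum>b\<in>Basis. (snd y \<bullet> frechet_derivative (transition d c)
      (at (transition c d (fst y))) b) *\<^sub>R b) has_derivative D) (at ?y)"
    unfolding D_def
    by (intro has_derivative_sum has_derivative_scaleR_left has_derivative_inner
        has_derivative_snd has_derivative_ident E')
  have "open (chart_map (lift c) ` (chart_dom (lift c) \<inter> chart_dom (lift d)))"
    unfolding lift_overlap_img[OF c] by (intro open_Times open_overlap c d open_UNIV)
  then have "(transition (lift c) (lift d) has_derivative (\<lambda>w. (Dtrans c d ?q (fst w), D w))) (at ?y)"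
    by (rule has_derivative_transform_within_open[OF has_derivative_Pair[OF 1 2]])
      (use z in \<open>auto simp: lift_transition[OF c d]\<close>)
  then show ?thesis by blast
qed

sublocale cot: differentiable_atlas "cotangent_atlas A"
proof
  fix C D assume *: "C \<in> cotangent_atlas A" "D \<in> cotangent_atlas A"
  then obtain c d where c: "c \<in> A" "C = lift c" and d: "d \<in> A" "D = lift d"
    by (auto simp: cotangent_atlas_def)
  show "inj_on (chart_map C) (chart_dom C)" using inj_on_lift c by simp
  show "open (chart_map C ` (chart_dom C \<inter> chart_dom D))"
    unfolding c(2) d(2) lift_overlap_img[OF c(1)] by (intro open_Times open_overlap c d open_UNIV)
  show "transition C D differentiable (at (chart_map C z))"
    if "z \<in> chart_dom C" "z \<in> chart_dom D" for z
    using lift_transition_has_derivative[OF c(1) d(1), of z] that c d by (auto simp: differentiable_def)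
qed

section \<open>The bundle projection and the symplectic form in lifted charts\<close>

lemma lift_in_charts_at:
  "c \<in> charts_at A (fst z) \<Longrightarrow> snd z \<in> cotangent_space A (fst z) \<Longrightarrow> lift c \<in> charts_at (cotangent_atlas A) z"
  by (auto simp: charts_at_def cotangent_atlas_def lift_dom)

lemma charts_at_cotangent:
  assumes "C \<in> charts_at (cotangent_atlas A) z"
  obtains c where "c \<in> charts_at A (fst z)" "C = lift c" "snd z \<in> cotangent_space A (fst z)"
  using assms that by (auto simp: charts_at_def cotangent_atlas_def lift_dom)

lemma fst_cot_Dtrans:
  assumes "c \<in> charts_at A (fst z)" "d \<in> charts_at A (fst z)" "snd z \<in> cotangent_space A (fst z)"
  shows "fst (cot.Dtrans (lift c) (lift d) z w) = Dtrans c d (fst z) (fst w)"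
proof -
  obtain D where D: "(transition (lift c) (lift d) has_derivative (\<lambda>w. (Dtrans c d (fst z) (fst w), D w)))
      (at (chart_map (lift c) z))"
    using lift_transition_has_derivative[of c d z] assms by (auto simp: charts_at_def lift_dom)
  show ?thesis unfolding cot.Dtrans_def frechet_derivative_at[OF D, symmetric] by simp
qed

text \<open>In a lifted chart the bundle projection reads \<open>(q, p) \<mapsto> q\<close>. The
  definition evaluates it in a picked chart \<open>lift k\<close>; passing to \<open>lift c\<close>
  uses that lifted transitions act on base components by \<open>Dtrans c k\<close>.\<close>

lemma tangent_map_fst:
  assumes c: "c \<in> charts_at A (fst z)" and z: "snd z \<in> cotangent_space A (fst z)"
    and w: "w \<in> tangent_space (cotangent_atlas A) z"
  shows "tangent_map (cotangent_atlas A) A fst z w = coord_tvec A c (fst z) (fst (w (lift c)))"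
proof
  fix d
  define K where "K = chart_at (cotangent_atlas A) z"
  have C: "lift c \<in> charts_at (cotangent_atlas A) z" using lift_in_charts_at[OF c z] .
  have "K \<in> charts_at (cotangent_atlas A) z"
    unfolding K_def by (rule chart_at_in) (use C in \<open>auto simp: carrier_def charts_at_def\<close>)
  then obtain k where k: "k \<in> charts_at A (fst z)" "K = lift k"
    by (rule charts_at_cotangent)
  have kA: "k \<in> A" using k by (simp add: charts_at_def)
  have K: "lift k \<in> charts_at (cotangent_atlas A) z" using lift_in_charts_at[OF k(1) z] .
  show "tangent_map (cotangent_atlas A) A fst z w d = coord_tvec A c (fst z) (fst (w (lift c))) d"
  proof (cases "d \<in> charts_at A (fst z)")
    case True
    have "((\<lambda>y. transition k d (fst y)) has_derivative (\<lambda>w. Dtrans k d (fst z) (fst w)))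
        (at (chart_map (lift k) z))"
      by (rule has_derivative_comp_fst)
        (use transition_has_derivative[OF k(1) True] in \<open>simp add: lift_map\<close>)
    then have "(chart_map d \<circ> fst \<circ> chart_inv (lift k) has_derivative (\<lambda>w. Dtrans k d (fst z) (fst w)))
        (at (chart_map (lift k) z))"
      by (rule has_derivative_transform_within_open[where s = "chart_img (lift k)"])
        (use K in \<open>auto simp: chart_img_def charts_at_def fst_lift_inv[OF kA] transition_def
           intro: cot.open_chart_img[unfolded chart_img_def]\<close>)
    then have "tangent_map (cotangent_atlas A) A fst z w d = Dtrans k d (fst z) (fst (w (lift k)))"
      using True by (simp add: tangent_map_def Let_def K_def[symmetric] k(2) frechet_derivative_at[symmetric])
    also have "w (lift k) = cot.Dtrans (lift c) (lift k) z (w (lift c))"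
      using w C K by (rule cot.tangent_change)
    finally show ?thesis
      using True by (simp add: fst_cot_Dtrans[OF c k(1) z] Dtrans_cocycle[OF c k(1)] coord_tvec_apply)
  qed (simp add: tangent_map_def Let_def coord_tvec_apply)
qed

text \<open>Taking \<open>lift c\<close> to be the very chart in which \<open>d1\<close> is
  evaluated avoids a change-of-chart formula for \<open>d1\<close> on \<open>T*Q\<close>. There the
  component of the canonical form along \<open>u\<close> is \<open>snd y \<bullet> fst u\<close>,
  which is linear in \<open>y\<close>.\<close>

lemma canonical_symplectic_form_coord:
  assumes z: "z \<in> carrier (cotangent_atlas A)" and C: "chart_at (cotangent_atlas A) z = lift c"
    and c: "c \<in> A"
  shows "canonical_symplectic_form A z v w =
    snd (w (lift c)) \<bullet> fst (v (lift c)) - snd (v (lift c)) \<bullet> fst (w (lift c))"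
proof -
  have Cz: "lift c \<in> charts_at (cotangent_atlas A) z" using chart_at_in[OF z] C by simp
  have cA: "lift c \<in> cotangent_atlas A" using Cz by (simp add: charts_at_def)
  have comp: "snd y \<bullet> fst u = canonical_one_form A (chart_inv (lift c) y)
      (coord_tvec (cotangent_atlas A) (lift c) (chart_inv (lift c) y) u)"
    if y: "y \<in> chart_img (lift c)" for y u
  proof -
    let ?z = "chart_inv (lift c) y"
    have zd: "?z \<in> chart_dom (lift c)" using chart_inv_in_dom[OF y] .
    then have c': "c \<in> charts_at A (fst ?z)" "snd ?z \<in> cotangent_space A (fst ?z)"
      using c by (auto simp: charts_at_def lift_dom)
    have C': "lift c \<in> charts_at (cotangent_atlas A) ?z" using zd cA by (simp add: charts_at_def)
    show ?thesis
      unfolding canonical_one_form_def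
        tangent_map_fst[OF c' cot.coord_tvec_in_tangent_space[OF C']]
        cotangent_apply[OF c'(2,1)] cot.coord_tvec_self[OF C']
      using chart_map_inv[OF y] by (metis lift_map snd_conv)
  qed
  have "frechet_derivative (\<lambda>y. canonical_one_form A (chart_inv (lift c) y)
      (coord_tvec (cotangent_atlas A) (lift c) (chart_inv (lift c) y) u)) (at (chart_map (lift c) z)) =
      (\<lambda>k. snd k \<bullet> fst u)" for u
  proof (rule frechet_derivative_at[symmetric])
    have "((\<lambda>y. snd y \<bullet> fst u) has_derivative (\<lambda>k. snd k \<bullet> fst u)) (at (chart_map (lift c) z))"
      by (auto intro!: derivative_eq_intros)
    then show "((\<lambda>y. canonical_one_form A (chart_inv (lift c) y)
      (coord_tvec (cotangent_atlas A) (lift c) (chart_inv (lift c) y) u)) has_derivative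
      (\<lambda>k. snd k \<bullet> fst u)) (at (chart_map (lift c) z))"
      by (rule has_derivative_transform_within_open[OF _ cot.open_chart_img[OF cA]])
        (use Cz comp in \<open>auto simp: chart_img_def charts_at_def\<close>)
  qed
  then show ?thesis by (simp add: canonical_symplectic_form_def d1_def Let_def C)
qed

subsection \<open>One-forms and integral curves\<close>

definition coeff ::
  "('a \<Rightarrow> ('a, 'e) tvec \<Rightarrow> real) \<Rightarrow> ('a, 'e) chart \<Rightarrow> 'e \<Rightarrow> 'e \<Rightarrow> real" where
  "coeff \<alpha> c u x = \<alpha> (chart_inv c x) (coord_tvec A c (chart_inv c x) u)"

text \<open>The coordinate map whose graph represents the section \<alpha> in the chart
  \<open>lift c\<close>; see \<open>lift_inv_local_form\<close>.\<close>

definition local_form ::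
  "('a \<Rightarrow> ('a, 'e) tvec \<Rightarrow> real) \<Rightarrow> ('a, 'e) chart \<Rightarrow> 'e \<Rightarrow> 'e" where
  "local_form \<alpha> c x = momentum c (chart_inv c x) (\<alpha> (chart_inv c x))"

lemma local_form_coeff: "local_form \<alpha> c x = (\<Sum>b\<in>Basis. coeff \<alpha> c b x *\<^sub>R b)"
  by (simp add: local_form_def momentum_def coeff_def)

context
  fixes \<alpha> :: "'a \<Rightarrow> ('a, 'e) tvec \<Rightarrow> real"
  assumes \<alpha>: "smooth_one_form A \<alpha>"
begin

lemma one_form_cotangent: "c \<in> charts_at A q \<Longrightarrow> \<alpha> q \<in> cotangent_space A q"
  using \<alpha> by (auto simp: smooth_one_form_def carrier_def charts_at_def)

lemma coeff_Ck: "c \<in> A \<Longrightarrow> Ck_on k (chart_img c) (coeff \<alpha> c u)"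
  using \<alpha> unfolding smooth_one_form_def smooth_on_def coeff_def by blast

definition Dlocal_form :: "('a, 'e) chart \<Rightarrow> 'e \<Rightarrow> 'e \<Rightarrow> 'e" where
  "Dlocal_form c x = frechet_derivative (local_form \<alpha> c) (at x)"

lemma local_form_has_derivative_sum:
  assumes "c \<in> A" "x \<in> chart_img c"
  shows "(local_form \<alpha> c has_derivative
    (\<lambda>v. \<Sum>b\<in>Basis. frechet_derivative (coeff \<alpha> c b) (at x) v *\<^sub>R b)) (at x)"
proof -
  have "(coeff \<alpha> c b has_derivative frechet_derivative (coeff \<alpha> c b) (at x)) (at x)" for b
    using Ck_on_1_has_derivative[OF coeff_Ck] assms by blast
  then show ?thesis
    unfolding local_form_coeff by (intro has_derivative_sum has_derivative_scaleR_left)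
qed

lemma local_form_has_derivative:
  assumes "c \<in> A" "x \<in> chart_img c"
  shows "(local_form \<alpha> c has_derivative Dlocal_form c x) (at x)"
  unfolding Dlocal_form_def frechet_derivative_at[OF local_form_has_derivative_sum[OF assms], symmetric]
  by (rule local_form_has_derivative_sum[OF assms])

lemma local_form_Ck1:
  assumes c: "c \<in> A"
  shows "Ck_on (Suc 0) (chart_img c) (local_form \<alpha> c)"
proof -
  have "continuous_on (chart_img c) (\<lambda>x. frechet_derivative (local_form \<alpha> c) (at x) v)" for v
  proof -
    have "continuous_on (chart_img c) (\<lambda>x. frechet_derivative (coeff \<alpha> c b) (at x) v)" for b
      using coeff_Ck[OF c, of "Suc 0"] by simp
    then have "continuous_on (chart_img c)
        (\<lambda>x. \<Sum>b\<in>Basis. frechet_derivative (coeff \<alpha> c b) (at x) v *\<^sub>R b)"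
      by (intro continuous_intros)
    then show ?thesis
      by (rule continuous_on_eq)
        (simp add: frechet_derivative_at[OF local_form_has_derivative_sum[OF c], symmetric])
  qed
  then show ?thesis
    using local_form_has_derivative[OF c] by (auto simp: differentiable_def)
qed

text \<open>The second derivatives of the transition map, which enter the change of coordinates of the
  partial derivatives of \<open>\<alpha>\<close>, cancel in \<open>d\<alpha>\<close> by symmetry.\<close>

lemma d1_in_chart:
  assumes c: "c \<in> charts_at A q" and v: "v \<in> tangent_space A q" and w: "w \<in> tangent_space A q"
  shows "d1 A \<alpha> q v w =
    Dlocal_form c (chart_map c q) (v c) \<bullet> w c - Dlocal_form c (chart_map c q) (w c) \<bullet> v c"
proof -
  define k where "k = chart_at A q"
  have k: "k \<in> charts_at A q"
    unfolding k_def by (rule chart_at_in) (use c in \<open>auto simp: carrier_def charts_at_def\<close>)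
  have cA: "c \<in> A" "q \<in> chart_dom c" and kA: "k \<in> A" "q \<in> chart_dom k"
    using c k by (auto simp: charts_at_def)
  let ?x = "chart_map k q" and ?y = "chart_map c q"
  let ?S = "chart_map k ` (chart_dom k \<inter> chart_dom c)"
  let ?D = "\<lambda>u x. frechet_derivative (transition k c) (at x) u"
  have S: "open ?S" "?x \<in> ?S" using open_overlap[OF kA(1) cA(1)] kA cA by auto
  have y: "?y \<in> chart_img c" using cA by (simp add: chart_img_def)
  have "\<exists>E. (?D u has_derivative E) (at ?x)" for u
    using Dtrans_differentiable[OF k c] by (simp add: differentiable_def)
  then obtain E where E: "\<And>u. (?D u has_derivative E u) (at ?x)" by metis
  have T: "(transition k c has_derivative (\<lambda>u. ?D u x)) (at x)" if "x \<in> ?S" for x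
    using Ck_on_1_has_derivative[OF Ck_transition[OF kA(1) cA(1)]] that by simp
  have sym: "E u u' = E u' u" for u u'
    by (rule second_derivative_symmetric[OF S, of "transition k c" "\<lambda>x u. ?D u x"]) (use T E in auto)
  \<comment> \<open>In the picked chart \<open>k\<close> the component along \<open>u\<close> is the
    local form in \<open>c\<close>, composed with the transition and paired with the transition's
    derivative applied to \<open>u\<close>. The product rule yields a second-derivative term
    \<open>E u h\<close> and a term in \<open>Dlocal_form\<close>.\<close>
  have der: "(coeff \<alpha> k u has_derivative
    (\<lambda>h. local_form \<alpha> c ?y \<bullet> E u h + Dlocal_form c ?y (Dtrans k c q h) \<bullet> Dtrans k c q u)) (at ?x)" for u
  proof -
    have "((\<lambda>x. local_form \<alpha> c (transition k c x)) has_derivative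
        (\<lambda>h. Dlocal_form c ?y (Dtrans k c q h))) (at ?x)"
      using has_derivative_compose[OF transition_has_derivative[OF k c], of "local_form \<alpha> c"]
        local_form_has_derivative[OF cA(1) y] kA by simp
    from has_derivative_inner[OF this E[of u]]
    have "((\<lambda>x. local_form \<alpha> c (transition k c x) \<bullet> ?D u x) has_derivative
      (\<lambda>h. local_form \<alpha> c ?y \<bullet> E u h + Dlocal_form c ?y (Dtrans k c q h) \<bullet> Dtrans k c q u)) (at ?x)"
      using kA by (simp add: Dtrans_def)
    then show ?thesis
    proof (rule has_derivative_transform_within_open[OF _ S])
      fix x assume "x \<in> ?S"
      then obtain p where p: "p \<in> chart_dom k" "p \<in> chart_dom c" "x = chart_map k p" by auto
      then have kp: "k \<in> charts_at A p" and cp: "c \<in> charts_at A p"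
        using kA cA by (auto simp: charts_at_def)
      have "coeff \<alpha> k u x = \<alpha> p (coord_tvec A c p (Dtrans k c p u))"
        using p kA by (simp add: coeff_def coord_tvec_change[OF kp cp])
      also have "\<dots> = local_form \<alpha> c (transition k c x) \<bullet> ?D u x"
        using p kA cA
        by (simp add: cotangent_apply[OF one_form_cotangent[OF cp] cp] local_form_def Dtrans_def)
      finally show "local_form \<alpha> c (transition k c x) \<bullet> ?D u x = coeff \<alpha> k u x" by simp
    qed
  qed
  have "d1 A \<alpha> q v w = frechet_derivative (coeff \<alpha> k (w k)) (at ?x) (v k) -
      frechet_derivative (coeff \<alpha> k (v k)) (at ?x) (w k)"
    by (simp add: d1_def Let_def k_def[symmetric] coeff_def[abs_def])
  then show ?thesis
    unfolding frechet_derivative_at[OF der, symmetric]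
    by (simp add: sym[of "w k" "v k"] tangent_change[OF v k c] tangent_change[OF w k c])
qed

lemma form_section_charts_at:
  "c \<in> charts_at A q \<Longrightarrow> lift c \<in> charts_at (cotangent_atlas A) (form_section \<alpha> q)"
  by (rule lift_in_charts_at) (auto simp: form_section_def intro: one_form_cotangent)

lemma lift_inv_local_form:
  assumes c: "c \<in> A" and x: "x \<in> chart_img c"
  shows "chart_inv (lift c) (x, local_form \<alpha> c x) = form_section \<alpha> (chart_inv c x)"
proof -
  let ?z = "form_section \<alpha> (chart_inv c x)"
  have "c \<in> charts_at A (chart_inv c x)"
    using c chart_inv_in_dom[OF x] by (simp add: charts_at_def)
  from form_section_charts_at[OF this] have "lift c \<in> cotangent_atlas A" "?z \<in> chart_dom (lift c)"
    by (auto simp: charts_at_def)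
  moreover have "chart_map (lift c) ?z = (x, local_form \<alpha> c x)"
    by (simp add: lift_map form_section_def local_form_def chart_map_inv[OF x])
  ultimately show ?thesis by (metis cot.chart_inv_map)
qed

text \<open>In the chart \<open>lift c\<close> the lifted curve is the base curve paired with its
  image under \<open>local_form \<alpha> c\<close>, so the chain rule gives its velocity; one
  direction is uniqueness of derivatives, the other the one-chart criterion.\<close>

lemma form_section_velocity:
  assumes c: "c \<in> charts_at A (\<gamma> t)" and ev: "\<forall>\<^sub>F s in at t. \<gamma> s \<in> chart_dom c"
    and der: "((chart_map c \<circ> \<gamma>) has_vector_derivative w) (at t)"
    and Z: "Z \<in> tangent_space (cotangent_atlas A) (form_section \<alpha> (\<gamma> t))"
  shows "has_velocity (cotangent_atlas A) (form_section \<alpha> \<circ> \<gamma>) Z t \<longleftrightarrow>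
    Z (lift c) = (w, Dlocal_form c (chart_map c (\<gamma> t)) w)"
proof -
  let ?Y = "chart_map (lift c) \<circ> (form_section \<alpha> \<circ> \<gamma>)"
  have cA: "c \<in> A" "\<gamma> t \<in> chart_dom c" using c by (auto simp: charts_at_def)
  have x: "chart_map c (\<gamma> t) \<in> chart_img c" using cA by (simp add: chart_img_def)
  have C: "lift c \<in> charts_at (cotangent_atlas A) ((form_section \<alpha> \<circ> \<gamma>) t)"
    using form_section_charts_at[OF c] by simp
  have evC: "\<forall>\<^sub>F s in at t. (form_section \<alpha> \<circ> \<gamma>) s \<in> chart_dom (lift c)"
    using ev
  proof eventually_elim
    case (elim s)
    then show ?case using form_section_charts_at[of c "\<gamma> s"] cA by (simp add: charts_at_def)
  qed
  have "((local_form \<alpha> c \<circ> (chart_map c \<circ> \<gamma>)) has_vector_derivative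
      Dlocal_form c (chart_map c (\<gamma> t)) w) (at t)"
    using vector_derivative_diff_chain_within[OF der has_derivative_at_withinI, of "local_form \<alpha> c"]
      local_form_has_derivative[OF cA(1) x] by simp
  from has_vector_derivative_Pair[OF der this]
  have "((\<lambda>s. ((chart_map c \<circ> \<gamma>) s, (local_form \<alpha> c \<circ> (chart_map c \<circ> \<gamma>)) s)) has_vector_derivative
      (w, Dlocal_form c (chart_map c (\<gamma> t)) w)) (at t)" .
  moreover have "\<forall>\<^sub>F s in at t. ((chart_map c \<circ> \<gamma>) s, (local_form \<alpha> c \<circ> (chart_map c \<circ> \<gamma>)) s) = ?Y s"
    using ev by eventually_elim (use cA in \<open>simp add: lift_map form_section_def local_form_def\<close>)
  ultimately have Y: "(?Y has_vector_derivative (w, Dlocal_form c (chart_map c (\<gamma> t)) w)) (at t)"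
    unfolding has_vector_derivative_def
    by (rule has_derivative_transform_eventually)
      (use cA in \<open>auto simp: lift_map form_section_def local_form_def\<close>)
  show ?thesis
  proof
    assume "has_velocity (cotangent_atlas A) (form_section \<alpha> \<circ> \<gamma>) Z t"
    then have "(?Y has_vector_derivative Z (lift c)) (at t)" using C by (simp add: has_velocity_def)
    from vector_derivative_unique_at[OF this Y]
    show "Z (lift c) = (w, Dlocal_form c (chart_map c (\<gamma> t)) w)" .
  next
    assume "Z (lift c) = (w, Dlocal_form c (chart_map c (\<gamma> t)) w)"
    with Y have "(?Y has_vector_derivative Z (lift c)) (at t)" by simp
    then show "has_velocity (cotangent_atlas A) (form_section \<alpha> \<circ> \<gamma>) Z t"
      using cot.has_velocityI[OF C _ evC] Z unfolding comp_apply by blast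
  qed
qed

section \<open>The associated vector field and its integral curves\<close>

context
  fixes Z :: "('a, 'e) covec \<Rightarrow> (('a, 'e) covec, 'e \<times> 'e) tvec"
  assumes Z: "smooth_vector_field (cotangent_atlas A) Z"
begin

lemma Z_tangent:
  "c \<in> charts_at A q \<Longrightarrow> Z (form_section \<alpha> q) \<in> tangent_space (cotangent_atlas A) (form_section \<alpha> q)"
  using Z form_section_charts_at[of c q] by (auto simp: smooth_vector_field_def carrier_def charts_at_def)

lemma associated_vector_field_coord:
  assumes c: "c \<in> charts_at A q"
  shows "associated_vector_field A Z \<alpha> q = coord_tvec A c q (fst (Z (form_section \<alpha> q) (lift c)))"
  using tangent_map_fst[of c "form_section \<alpha> q"] c one_form_cotangent[OF c] Z_tangent[OF c]
  by (simp add: associated_vector_field_def form_section_def)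

text \<open>In the chart the field is \<open>F\<close>, the base part of \<open>Z\<close> along the
  graph of the local form. It is locally Lipschitz as a composite of C^1 maps, so a local solution
  exists and is carried back by \<open>chart_inv c\<close>.\<close>

lemma exists_integral_curve:
  assumes c: "c \<in> charts_at A q"
  obtains T \<gamma> where "T > 0" "\<gamma> 0 = q"
    "integral_curve A (associated_vector_field A Z \<alpha>) {-T<..<T} \<gamma>"
proof -
  have cA: "c \<in> A" "q \<in> chart_dom c" using c by (auto simp: charts_at_def)
  let ?a = "local_form \<alpha> c" and ?x0 = "chart_map c q"
  have x0: "?x0 \<in> chart_img c" using cA by (simp add: chart_img_def)
  define G where "G y = Z (chart_inv (lift c) y) (lift c)" for y
  define F where "F x = fst (G (x, ?a x))" for x
  have C: "lift c \<in> cotangent_atlas A" using cA by (simp add: cotangent_atlas_def)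
  have GCk: "Ck_on (Suc 0) (chart_img (lift c)) G"
    using Z C unfolding smooth_vector_field_def smooth_on_def G_def by blast
  obtain r1 L1 where 1: "r1 > 0" "cball ?x0 r1 \<subseteq> chart_img c" "L1 \<ge> 0"
    "\<And>x y. x \<in> cball ?x0 r1 \<Longrightarrow> y \<in> cball ?x0 r1 \<Longrightarrow> norm (?a x - ?a y) \<le> L1 * norm (x - y)"
    using Ck_on_1_locally_lipschitz[OF local_form_Ck1[OF cA(1)] open_chart_img[OF cA(1)] x0] by blast
  have "(?x0, ?a ?x0) \<in> chart_img (lift c)" using x0 by (simp add: lift_img cA)
  then obtain r2 L2 where 2: "r2 > 0" "L2 \<ge> 0"
    "\<And>x y. x \<in> cball (?x0, ?a ?x0) r2 \<Longrightarrow> y \<in> cball (?x0, ?a ?x0) r2 \<Longrightarrow>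
      norm (G x - G y) \<le> L2 * norm (x - y)"
    using Ck_on_1_locally_lipschitz[OF GCk cot.open_chart_img[OF C]] by metis
  \<comment> \<open>The graph map is Lipschitz with constant \<open>1 + L1\<close>, so over a ball
    of this radius the graph stays in the ball of radius \<open>r2\<close> where \<open>G\<close> is
    Lipschitz.\<close>
  define r where "r = min r1 (r2 / (1 + L1))"
  have r: "r > 0" "cball ?x0 r \<subseteq> chart_img c" using 1 2 by (auto simp: r_def)
  have graph: "norm ((x, ?a x) - (y, ?a y)) \<le> (1 + L1) * norm (x - y)"
    if "x \<in> cball ?x0 r" "y \<in> cball ?x0 r" for x y
    using norm_Pair_le[of "x - y" "?a x - ?a y"] 1(4)[of x y] that by (simp add: r_def algebra_simps)
  have in_ball: "(x, ?a x) \<in> cball (?x0, ?a ?x0) r2" if x: "x \<in> cball ?x0 r" for x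
  proof -
    have "norm ((?x0, ?a ?x0) - (x, ?a x)) \<le> (1 + L1) * norm (?x0 - x)"
      by (rule graph) (use x r in auto)
    also have "\<dots> \<le> (1 + L1) * (r2 / (1 + L1))"
      using x 1(3) by (intro mult_left_mono) (auto simp: r_def dist_norm)
    finally show ?thesis using 1(3) by (simp add: dist_norm)
  qed
  have "norm (F x - F y) \<le> L2 * (1 + L1) * norm (x - y)"
    if xy: "x \<in> cball ?x0 r" "y \<in> cball ?x0 r" for x y
  proof -
    have "norm (F x - F y) \<le> norm (G (x, ?a x) - G (y, ?a y))"
      unfolding F_def fst_diff[symmetric] by (metis norm_fst_le prod.collapse)
    also have "\<dots> \<le> L2 * norm ((x, ?a x) - (y, ?a y))" by (rule 2(3)) (use in_ball xy in auto)
    also have "\<dots> \<le> L2 * ((1 + L1) * norm (x - y))" by (intro mult_left_mono graph xy 2)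
    finally show ?thesis by (simp add: mult.assoc)
  qed
  from locally_lipschitz_imp_local_flow[OF r(1) this] obtain T x where T: "T > 0" "x 0 = ?x0"
    "\<And>t. t \<in> {-T<..<T} \<Longrightarrow> x t \<in> cball ?x0 r"
    "\<And>t. t \<in> {-T<..<T} \<Longrightarrow> (x has_vector_derivative F (x t)) (at t)"
    by metis
  have img: "x t \<in> chart_img c" if "t \<in> {-T<..<T}" for t using T(3)[OF that] r(2) by blast
  let ?\<gamma> = "\<lambda>t. chart_inv c (x t)"
  show ?thesis
  proof (rule that[of T ?\<gamma>])
    show "T > 0" by (rule T)
    show "?\<gamma> 0 = q" using T(2) cA by simp
    show "integral_curve A (associated_vector_field A Z \<alpha>) {-T<..<T} ?\<gamma>"
      unfolding integral_curve_def
    proof (intro ballI has_velocityI)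
      fix t assume t: "t \<in> {-T<..<T}"
      show ct: "c \<in> charts_at A (?\<gamma> t)"
        using cA chart_inv_in_dom[OF img[OF t]] by (simp add: charts_at_def)
      show "associated_vector_field A Z \<alpha> (?\<gamma> t) \<in> tangent_space A (?\<gamma> t)"
        unfolding associated_vector_field_coord[OF ct] by (rule coord_tvec_in_tangent_space[OF ct])
      have ev: "\<forall>\<^sub>F s in at t. s \<in> {-T<..<T}"
        using t by (intro eventually_at_in_open') auto
      then show "\<forall>\<^sub>F s in at t. ?\<gamma> s \<in> chart_dom c"
        by (rule eventually_mono) (rule chart_inv_in_dom[OF img])
      have "associated_vector_field A Z \<alpha> (?\<gamma> t) c = F (x t)"
        by (simp add: associated_vector_field_coord[OF ct] coord_tvec_self[OF ct] F_def G_def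
            lift_inv_local_form[OF cA(1) img[OF t]])
      moreover have "((chart_map c \<circ> ?\<gamma>) has_vector_derivative F (x t)) (at t)"
        by (rule has_vector_derivative_transform_within_open[OF T(4)[OF t] open_greaterThanLessThan t])
          (simp add: chart_map_inv img)
      ultimately show "((chart_map c \<circ> ?\<gamma>) has_vector_derivative
          associated_vector_field A Z \<alpha> (?\<gamma> t) c) (at t)" by simp
    qed
  qed
qed

end

text \<open>In a chart where \<open>\<omega>\<close> takes its canonical form, Hamilton's equations turn
  \<open>i(X)d\<alpha> = -d(\<alpha>\<^sup>*H)\<close> into the statement that \<open>Z\<close> is tangent to the graph of \<open>\<alpha>\<close>.\<close>

lemma HJ_equation_iff:
  assumes H: "smooth_function (cotangent_atlas A) H" and ham: "hamiltonian_vector_field A H Z"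
    and q: "q \<in> carrier A"
  obtains c where "c \<in> charts_at A q"
    "(\<forall>v\<in>tangent_space A q. interior_product (associated_vector_field A Z \<alpha>) (d1 A \<alpha>) q v =
       - d0 A (H \<circ> form_section \<alpha>) q v) \<longleftrightarrow>
     snd (Z (form_section \<alpha> q) (lift c)) =
       Dlocal_form c (chart_map c q) (fst (Z (form_section \<alpha> q) (lift c)))"
proof -
  let ?z = "form_section \<alpha> q" and ?cot = "cotangent_atlas A"
  have Z: "smooth_vector_field ?cot Z" using ham by (simp add: hamiltonian_vector_field_def)
  have "chart_at A q \<in> charts_at A q" using chart_at_in[OF q] .
  from form_section_charts_at[OF this] have z: "?z \<in> carrier ?cot"
    by (auto simp: carrier_def charts_at_def)
  \<comment> \<open>The chart is dictated by the one picked on \<open>T*Q\<close>, where the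
    symplectic form is known. The chart picked on \<open>Q\<close> at \<open>q\<close> may differ,
    so \<open>d0\<close> and \<open>d1\<close> on \<open>Q\<close> are evaluated through
    \<open>d0_in_chart\<close> and \<open>d1_in_chart\<close>.\<close>
  obtain c where c: "c \<in> charts_at A q" and C: "chart_at ?cot ?z = lift c"
    by (rule charts_at_cotangent[OF chart_at_in[OF z]]) (auto simp: form_section_def)
  have cA: "c \<in> A" "q \<in> chart_dom c" using c by (auto simp: charts_at_def)
  let ?x = "chart_map c q" and ?a = "local_form \<alpha> c" and ?H = "H \<circ> chart_inv (lift c)"
  let ?D = "Dlocal_form c ?x"
  have x: "?x \<in> chart_img c" using cA by (simp add: chart_img_def)
  have Cz: "lift c \<in> charts_at ?cot ?z" by (rule form_section_charts_at[OF c])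
  obtain X P where XP: "Z ?z (lift c) = (X, P)" by fastforce
  define H' where "H' = frechet_derivative ?H (at (?x, ?a ?x))"
  have "(?x, ?a ?x) \<in> chart_img (lift c)" using x by (simp add: lift_img cA)
  then have H': "(?H has_derivative H') (at (?x, ?a ?x))"
    using H Cz unfolding H'_def smooth_function_def smooth_on_def charts_at_def
    by (blast intro: Ck_on_1_has_derivative)
  have Cx: "chart_map (lift c) ?z = (?x, ?a ?x)"
    using cA by (simp add: lift_map form_section_def local_form_def)
  \<comment> \<open>Hamilton's equations: \<open>X\<close> is the momentum gradient of
    \<open>H\<close> and \<open>P\<close> minus its position gradient, read off by testing on all
    coordinate vectors.\<close>
  have hamilton: "H' u = X \<bullet> snd u - P \<bullet> fst u" for u
  proof -
    let ?w = "coord_tvec ?cot (lift c) ?z u"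
    have w: "?w \<in> tangent_space ?cot ?z" by (rule cot.coord_tvec_in_tangent_space[OF Cz])
    have "H' u = d0 ?cot H ?z ?w"
      using cot.d0_in_chart[OF Cz w, of H H'] H' by (simp add: Cx cot.coord_tvec_self[OF Cz])
    also have "\<dots> = interior_product Z (canonical_symplectic_form A) ?z ?w"
      using ham z w by (simp add: hamiltonian_vector_field_def)
    also have "\<dots> = X \<bullet> snd u - P \<bullet> fst u"
      by (simp add: interior_product_def canonical_symplectic_form_coord[OF z C cA(1)]
          cot.coord_tvec_self[OF Cz] XP inner_commute)
    finally show ?thesis .
  qed
  have "((\<lambda>x. ?H (x, ?a x)) has_derivative (\<lambda>v. H' (v, ?D v))) (at ?x)"
    using has_derivative_compose[OF has_derivative_Pair[OF has_derivative_ident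
      local_form_has_derivative[OF cA(1) x]] H'] .
  then have pullback: "((H \<circ> form_section \<alpha>) \<circ> chart_inv c has_derivative (\<lambda>v. H' (v, ?D v))) (at ?x)"
    by (rule has_derivative_transform_within_open[OF _ open_chart_img[OF cA(1)] x])
      (simp add: lift_inv_local_form cA)
  let ?X = "associated_vector_field A Z \<alpha> q"
  have X: "?X = coord_tvec A c q X" by (simp add: associated_vector_field_coord[OF Z c] XP)
  have Xt: "?X \<in> tangent_space A q" unfolding X by (rule coord_tvec_in_tangent_space[OF c])
  have Xc: "?X c = X" by (simp add: X coord_tvec_self[OF c])
  \<comment> \<open>The left side is \<open>?D X \<bullet> v c - ?D (v c) \<bullet> X\<close>, the
    right side \<open>P \<bullet> v c - X \<bullet> ?D (v c)\<close>; the terms with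
    \<open>?D (v c)\<close> cancel.\<close>
  have "interior_product (associated_vector_field A Z \<alpha>) (d1 A \<alpha>) q v = - d0 A (H \<circ> form_section \<alpha>) q v
      \<longleftrightarrow> ?D X \<bullet> v c = P \<bullet> v c" if v: "v \<in> tangent_space A q" for v
    unfolding interior_product_def d1_in_chart[OF c Xt v] d0_in_chart[OF c v pullback] hamilton Xc
    by (auto simp: inner_commute)
  moreover have "(\<forall>v\<in>tangent_space A q. ?D X \<bullet> v c = P \<bullet> v c) \<longleftrightarrow> P = ?D X"
  proof
    assume *: "\<forall>v\<in>tangent_space A q. ?D X \<bullet> v c = P \<bullet> v c"
    \<comment> \<open>Every vector \<open>u\<close> of the model space is the component in
      \<open>c\<close> of some tangent vector.\<close>
    have "?D X \<bullet> u = P \<bullet> u" for u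
      using bspec[OF * coord_tvec_in_tangent_space[OF c, of u]] by (simp add: coord_tvec_self[OF c])
    then show "P = ?D X" by (metis inner_diff_left inner_eq_zero_iff right_minus_eq)
  qed simp
  ultimately show ?thesis using that[OF c] by (simp add: XP)
qed

end

end

section \<open>Equivalence of the lifting property with the equation for the differential of
  \<alpha>\<close>

theorem theorem2:
  fixes A :: "('a, 'e::euclidean_space) chart set"
    and H :: "('a, 'e) covec \<Rightarrow> real"
    and Z :: "('a, 'e) covec \<Rightarrow> (('a, 'e) covec, 'e \<times> 'e) tvec"
    and \<alpha> :: "'a \<Rightarrow> ('a, 'e) tvec \<Rightarrow> real"
  assumes "smooth_manifold A"
    and "smooth_function (cotangent_atlas A) H"
    and "hamiltonian_vector_field A H Z"
    and "smooth_one_form A \<alpha>"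
  shows "generalized_HJ_solution A Z \<alpha> \<longleftrightarrow>
    (\<forall>q\<in>carrier A. \<forall>v\<in>tangent_space A q.
       interior_product (associated_vector_field A Z \<alpha>) (d1 A \<alpha>) q v =
       - d0 A (H \<circ> form_section \<alpha>) q v)"
    (is "?L \<longleftrightarrow> (\<forall>q\<in>carrier A. ?R q)")
proof -
  interpret atlas A using assms(1) by unfold_locales (simp add: smooth_manifold_def)
  note HJ = HJ_equation_iff[OF assms(4) assms(2,3)]
  have Z: "smooth_vector_field (cotangent_atlas A) Z"
    using assms(3) by (simp add: hamiltonian_vector_field_def)
  \<comment> \<open>An equivalence at a single instant: the base part of the velocity already agrees
    by the choice of the associated field, so only the momentum part remains, and that is the
    equation at this point.\<close>
  have lift_iff: "has_velocity (cotangent_atlas A) (form_section \<alpha> \<circ> \<gamma>) (Z (form_section \<alpha> (\<gamma> t))) t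
      \<longleftrightarrow> ?R (\<gamma> t)"
    if vel: "has_velocity A \<gamma> (associated_vector_field A Z \<alpha> (\<gamma> t)) t" for \<gamma> t
  proof -
    have q: "\<gamma> t \<in> carrier A" using vel by (simp add: has_velocity_def)
    obtain c where c: "c \<in> charts_at A (\<gamma> t)" and R: "?R (\<gamma> t) \<longleftrightarrow>
        snd (Z (form_section \<alpha> (\<gamma> t)) (lift c)) =
        Dlocal_form \<alpha> c (chart_map c (\<gamma> t)) (fst (Z (form_section \<alpha> (\<gamma> t)) (lift c)))"
      using HJ[OF q] by blast
    have "associated_vector_field A Z \<alpha> (\<gamma> t) c = fst (Z (form_section \<alpha> (\<gamma> t)) (lift c))"
      by (simp add: associated_vector_field_coord[OF assms(4) Z c] coord_tvec_self[OF c])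
    then have ev: "\<forall>\<^sub>F s in at t. \<gamma> s \<in> chart_dom c" and
      der: "((chart_map c \<circ> \<gamma>) has_vector_derivative fst (Z (form_section \<alpha> (\<gamma> t)) (lift c))) (at t)"
      using vel c by (auto simp: has_velocity_def)
    show ?thesis
      unfolding form_section_velocity[OF assms(4) c ev der Z_tangent[OF assms(4) Z c]] R
      by (simp add: prod_eq_iff)
  qed
  show ?thesis
  proof
    assume sol: ?L
    show "\<forall>q\<in>carrier A. ?R q"
    proof
      fix q assume q: "q \<in> carrier A"
      \<comment> \<open>Through each point runs an integral curve; the lifting property at time 0
        gives the equation there.\<close>
      obtain T \<gamma> where \<gamma>: "T > 0" "\<gamma> 0 = q"
        "integral_curve A (associated_vector_field A Z \<alpha>) {-T<..<T} \<gamma>"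
        using exists_integral_curve[OF assms(4) Z chart_at_in[OF q]] by blast
      then have "integral_curve (cotangent_atlas A) Z {-T<..<T} (form_section \<alpha> \<circ> \<gamma>)"
        using sol by (simp add: generalized_HJ_solution_def is_interval_oo)
      moreover have "0 \<in> {-T<..<T}" using \<gamma>(1) by simp
      ultimately show "?R q"
        using lift_iff[of \<gamma> 0] \<gamma>(2,3) unfolding integral_curve_def comp_apply by blast
    qed
  next
    assume R: "\<forall>q\<in>carrier A. ?R q"
    show ?L
      unfolding generalized_HJ_solution_def
    proof (intro allI impI)
      fix I \<gamma>
      assume "open I \<and> is_interval I \<and> integral_curve A (associated_vector_field A Z \<alpha>) I \<gamma>"
      then have vel: "has_velocity A \<gamma> (associated_vector_field A Z \<alpha> (\<gamma> t)) t" if "t \<in> I" for t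
        using that by (simp add: integral_curve_def)
      have "\<gamma> t \<in> carrier A" if "t \<in> I" for t using vel[OF that] by (simp add: has_velocity_def)
      then show "integral_curve (cotangent_atlas A) Z I (form_section \<alpha> \<circ> \<gamma>)"
        using lift_iff[OF vel] R unfolding integral_curve_def comp_apply by blast
    qed
  qed
qed

end
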